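(* Let $\mathcal{A}$ be a multiarrangement of linear hyperplanes in $\mathbb{C}^n$ obtained by complexifying a multiarrangement of linear hyperplanes in $\mathbb{R}^n$, and let $\mathcal{A}^{\mathrm{gen}}$ be a generic affine arrangement in $\mathbb{R}^n$ determined by $\mathcal{A}$. Then $$\operatorname{Hilb}(\mathcal{E}_{\mathcal{A}};1,t)=\sum_{0\le i\le n}f_{n-i}(\mathcal{A}^{\mathrm{gen}})\cdot t^i,$$ where $\mathcal{E}_{\mathcal{A}}=\Omega_n/I_{\mathcal{A}}$ and $f_i(\mathcal{A}^{\mathrm{gen}})$ is the number of $i$-dimensional faces of the polyhedral complex on $\mathbb{R}^n$ induced by $\mathcal{A}^{\mathrm{gen}}$.
   Context: Superspace: $\Omega_n=\mathbb{C}[x_1,\dots,x_n]\otimes\wedge\{\theta_1,\dots,\theta_n\}$, where the $x_i$ commute and the $\theta_i$ anticommute; bigraded with $x_i$ in degree $(1,0)$ and $\theta_i$ in degree $(0,1)$. The Euler operator is $df=\sum_{i=1}^n(\partial f/\partial x_i)\cdot\theta_i$ (with $\theta$-variables treated as constants). A multiarrangement is a finite collection $\mathcal{A}=\{H_1,\dots,H_m\}$ of hyperplanes, repeats allowed. For a line $L=\mathbb{C}\cdot(\ell_1,\dots,\ell_n)$ in $\mathbb{C}^n$ put $\lambda_L=\ell_1x_1+\cdots+\ell_nx_n$ and $\rho_{\mathcal{A}}(L)=\#\{1\le i\le m:L\not\subseteq H_i\}$. Then $$I_{\mathcal{A}}=\left(\lambda_L^{\rho_{\mathcal{A}}(L)+1},\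 d\big(\lambda_L^{\rho_{\mathcal{A}}(L)+1}\big)\ :\ L\subseteq\mathbb{C}^n\text{ a line}\right)\subseteq\Omega_n .$$ $\operatorname{Hilb}(V;q,t)=\sum_{i,j}\dim_{\mathbb{C}}(V_{i,j})q^it^j$ with $i$ bosonic and $j$ fermionic degree; here it is evaluated at $q=1$. Generic arrangement: $\mathcal{A}^{\mathrm{gen}}$ is an affine hyperplane arrangement in $\mathbb{R}^n$ whose hyperplanes are affine translates of the (real) linear hyperplanes of $\mathcal{A}$, one translate for each member of $\mathcal{A}$ counted with multiplicity, such that any $k$ of these hyperplanes have nonempty intersection if and only if their normal vectors form a linearly independent set (family). *)

theory Defs
  imports
    "HOL-Analysis.Analysis"
    "HOL-Library.Poly_Mapping"
    "HOL-Computational_Algebra.Polynomial"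
    "HOL-Algebra.QuotRing"
    "HOL-Algebra.Embedded_Algebras"
    "HOL-Algebra.Algebraic_Closure_Type"
begin

section \<open>Superspace\<close>

type_synonym 'n mpoly = "('n \<Rightarrow>\<^sub>0 nat) \<Rightarrow>\<^sub>0 complex"

text \<open>
  Superspace is modelled as a free module over the polynomial ring \<open>'n mpoly\<close> with basis
  \<open>\<theta>\<^sub>S = \<theta>\<^bsub>s\<^sub>1\<^esub> \<and> \<dots> \<and> \<theta>\<^bsub>s\<^sub>k\<^esub>\<close> where \<open>S = {s\<^sub>1 < \<dots> < s\<^sub>k}\<close> ranges over the sets of indices; an element
  is its family of coefficients.  The index type \<open>'n\<close> plays the role of \<open>{1, \<dots>, n}\<close>.
\<close>

typedef 'n superspace = "UNIV :: ('n set \<Rightarrow> 'n mpoly) set"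
  morphisms super_coeff Superspace ..

lemma super_coeff_Superspace [simp]: "super_coeff (Superspace f) = f"
  by (simp add: Superspace_inverse)

lemma superspace_eqI: "(\<And>S. super_coeff f S = super_coeff g S) \<Longrightarrow> f = g"
  by (metis ext super_coeff_inverse)

text \<open>For disjoint \<open>S\<close> and \<open>T\<close> one has \<open>\<theta>\<^sub>S \<theta>\<^sub>T = \<plusminus> \<theta>\<^bsub>S \<union> T\<^esub>\<close>, the sign being that of the permutation that
  sorts the concatenation of \<open>S\<close> and \<open>T\<close>.\<close>

definition wedge_sign :: "'n::linorder set \<Rightarrow> 'n set \<Rightarrow> 'n mpoly" where
  "wedge_sign S T = (- 1) ^ card {(s, t). s \<in> S \<and> t \<in> T \<and> t < s}"

lemma wedge_sign_empty [simp]: "wedge_sign {} T = 1" "wedge_sign S {} = 1"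
  by (simp_all add: wedge_sign_def)

lemma wedge_sign_Un_left:
  fixes S T U :: "'n::{finite,linorder} set"
  assumes "S \<inter> T = {}"
  shows "wedge_sign (S \<union> T) U = wedge_sign S U * wedge_sign T U"
proof -
  have "{(s, t). s \<in> S \<union> T \<and> t \<in> U \<and> t < s} =
      {(s, t). s \<in> S \<and> t \<in> U \<and> t < s} \<union> {(s, t). s \<in> T \<and> t \<in> U \<and> t < s}"
    by auto
  moreover have "{(s, t). s \<in> S \<and> t \<in> U \<and> t < s} \<inter> {(s, t). s \<in> T \<and> t \<in> U \<and> t < s} = {}"
    using assms by auto
  ultimately show ?thesis
    by (simp add: wedge_sign_def card_Un_disjoint power_add)
qed

lemma wedge_sign_Un_right:
  fixes S T U :: "'n::{finite,linorder} set"
  assumes "T \<inter> U = {}"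
  shows "wedge_sign S (T \<union> U) = wedge_sign S T * wedge_sign S U"
proof -
  have "{(s, t). s \<in> S \<and> t \<in> T \<union> U \<and> t < s} =
      {(s, t). s \<in> S \<and> t \<in> T \<and> t < s} \<union> {(s, t). s \<in> S \<and> t \<in> U \<and> t < s}"
    by auto
  moreover have "{(s, t). s \<in> S \<and> t \<in> T \<and> t < s} \<inter> {(s, t). s \<in> S \<and> t \<in> U \<and> t < s} = {}"
    using assms by auto
  ultimately show ?thesis
    by (simp add: wedge_sign_def card_Un_disjoint power_add)
qed

instantiation superspace :: ("{finite,linorder}") ring_1
begin

definition "0 = Superspace (\<lambda>_. 0)"
definition "1 = Superspace (\<lambda>S. if S = {} then 1 else 0)"
definition "f + g = Superspace (\<lambda>S. super_coeff f S + super_coeff g S)"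
definition "- f = Superspace (\<lambda>S. - super_coeff f S)"
definition "f - g = Superspace (\<lambda>S. super_coeff f S - super_coeff g S)"
definition "f * g = Superspace
  (\<lambda>S. \<Sum>T\<in>Pow S. wedge_sign T (S - T) * super_coeff f T * super_coeff g (S - T))"

instance
proof
  fix f g h :: "'a superspace"
  show "f * g * h = f * (g * h)"
  proof (rule superspace_eqI)
    fix S :: "'a set"
    let ?F = "super_coeff f" and ?G = "super_coeff g" and ?H = "super_coeff h"
    have "super_coeff (f * g * h) S =
        (\<Sum>(T, U)\<in>Sigma (Pow S) Pow.
          wedge_sign T (S - T) * (wedge_sign U (T - U) * ?F U * ?G (T - U)) * ?H (S - T))"
      by (simp add: times_superspace_def sum_distrib_left sum_distrib_right
          sum.Sigma[symmetric])
    also have "\<dots> = (\<Sum>(U, V)\<in>Sigma (Pow S) (\<lambda>U. Pow (S - U)).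
          wedge_sign U (S - U) * ?F U * (wedge_sign V (S - U - V) * ?G V * ?H (S - U - V)))"
    proof (rule sum.reindex_bij_witness
        [where i = "\<lambda>(U, V). (U \<union> V, U)" and j = "\<lambda>(T, U). (U, T - U)"], goal_cases)
      case (5 p)
      then obtain T U where p: "p = (T, U)" and sub: "U \<subseteq> T" "T \<subseteq> S"
        by (cases p) auto
      have S: "S - U - (T - U) = S - T" "S - U = (T - U) \<union> (S - T)"
        using sub by auto
      have "wedge_sign T (S - T) = wedge_sign U (S - T) * wedge_sign (T - U) (S - T)"
        using wedge_sign_Un_left[of U "T - U" "S - T"] sub by (simp add: Un_absorb1)
      moreover have "wedge_sign U (S - U) = wedge_sign U (T - U) * wedge_sign U (S - T)"
        unfolding S(2) by (rule wedge_sign_Un_right) auto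
      ultimately show ?case
        unfolding p by (simp add: S(1) mult_ac)
    qed auto
    also have "\<dots> = super_coeff (f * (g * h)) S"
      by (simp add: times_superspace_def sum_distrib_left sum.Sigma[symmetric])
    finally show "super_coeff (f * g * h) S = super_coeff (f * (g * h)) S" .
  qed
  show "1 * f = f"
  proof (rule superspace_eqI)
    fix S :: "'a set"
    have "super_coeff (1 * f) S = (\<Sum>T\<in>Pow S. if T = {} then super_coeff f S else 0)"
      unfolding times_superspace_def one_superspace_def super_coeff_Superspace
      by (rule sum.cong) auto
    then show "super_coeff (1 * f) S = super_coeff f S" by simp
  qed
  show "f * 1 = f"
  proof (rule superspace_eqI)
    fix S :: "'a set"
    have "super_coeff (f * 1) S = (\<Sum>T\<in>Pow S. if T = S then super_coeff f S else 0)"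
      unfolding times_superspace_def one_superspace_def super_coeff_Superspace
      by (rule sum.cong) auto
    then show "super_coeff (f * 1) S = super_coeff f S" by simp
  qed
  have "super_coeff (0::'a superspace) {} \<noteq> super_coeff 1 {}"
    by (simp add: zero_superspace_def one_superspace_def)
  then show "(0::'a superspace) \<noteq> 1" by auto
  show "(f + g) * h = f * h + g * h"
    by (rule superspace_eqI)
      (simp add: plus_superspace_def times_superspace_def ring_distribs sum.distrib)
  show "f * (g + h) = f * g + f * h"
    by (rule superspace_eqI)
      (simp add: plus_superspace_def times_superspace_def ring_distribs sum.distrib)
  show "f + g + h = f + (g + h)" "f + g = g + f"
    by (rule superspace_eqI, simp add: plus_superspace_def add_ac)+
  show "0 + f = f" "- f + f = 0" "f - g = f + - g"
    by (rule superspace_eqI, simp add: zero_superspace_def plus_superspace_def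
        uminus_superspace_def minus_superspace_def)+
qed

end

lemma ring_superspace: "ring (ring_of_type_algebra :: 'n::{finite,linorder} superspace ring)"
proof -
  have "\<exists>y. y + x = 0 \<and> x + y = 0" for x :: "'n superspace"
    by (rule exI[of _ "- x"]) simp
  then show ?thesis
    unfolding ring_of_type_algebra_def
    by unfold_locales (auto simp: algebra_simps Units_def)
qed

definition super_poly :: "'n mpoly \<Rightarrow> 'n superspace" where
  "super_poly p = Superspace (\<lambda>S. if S = {} then p else 0)"

definition super_const :: "complex \<Rightarrow> 'n superspace" where
  "super_const c = super_poly (Poly_Mapping.single 0 c)"

definition super_x :: "'n \<Rightarrow> 'n superspace" where
  "super_x i = super_poly (Poly_Mapping.single (Poly_Mapping.single i 1) 1)"

definition super_theta :: "'n \<Rightarrow> 'n superspace" where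
  "super_theta i = Superspace (\<lambda>S. if S = {i} then 1 else 0)"

text \<open>The bihomogeneous elements of bosonic degree \<open>i\<close> and fermionic degree \<open>j\<close>.\<close>

definition super_part :: "nat \<Rightarrow> nat \<Rightarrow> 'n::finite superspace set" where
  "super_part i j =
    {f. \<forall>S. \<forall>m\<in>Poly_Mapping.keys (super_coeff f S).
      (\<Sum>k\<in>UNIV. Poly_Mapping.lookup m k) = i \<and> card S = j}"

text \<open>In the terms with \<open>lookup m i = 0\<close> the truncated exponent \<open>m - single i 1\<close> is irrelevant, since the
  coefficient vanishes.\<close>

definition mpoly_pderiv :: "'n \<Rightarrow> 'n mpoly \<Rightarrow> 'n mpoly" where
  "mpoly_pderiv i p =
    (\<Sum>m\<in>Poly_Mapping.keys p.
      Poly_Mapping.single (m - Poly_Mapping.single i 1)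
        (of_nat (Poly_Mapping.lookup m i) * Poly_Mapping.lookup p m))"

definition super_pderiv :: "'n \<Rightarrow> 'n superspace \<Rightarrow> 'n superspace" where
  "super_pderiv i f = Superspace (\<lambda>S. mpoly_pderiv i (super_coeff f S))"

definition euler :: "'n::{finite,linorder} superspace \<Rightarrow> 'n superspace" where
  "euler f = (\<Sum>i\<in>UNIV. super_pderiv i f * super_theta i)"


section \<open>The quotient attached to a multiarrangement\<close>

text \<open>A multiarrangement is a list of hyperplanes; the order of the entries plays no role.\<close>

definition linear_hyperplane :: "('k::field ^ 'n) set \<Rightarrow> bool" where
  "linear_hyperplane H \<longleftrightarrow> (\<exists>a. a \<noteq> 0 \<and> H = {x. (\<Sum>k\<in>UNIV. a $ k * x $ k) = 0})"

definition complexify :: "(real ^ 'n) set \<Rightarrow> (complex ^ 'n) set" where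
  "complexify H = {z. (\<chi> k. Re (z $ k)) \<in> H \<and> (\<chi> k. Im (z $ k)) \<in> H}"

definition line_through :: "complex ^ 'n \<Rightarrow> (complex ^ 'n) set" where
  "line_through l = range (\<lambda>c. c *s l)"

definition rho :: "(complex ^ 'n) set list \<Rightarrow> (complex ^ 'n) set \<Rightarrow> nat" where
  "rho A L = card {i. i < length A \<and> \<not> L \<subseteq> A ! i}"

definition lambda_form :: "complex ^ 'n::{finite,linorder} \<Rightarrow> 'n superspace" where
  "lambda_form l = (\<Sum>k\<in>UNIV. super_const (l $ k) * super_x k)"

text \<open>The form \<open>lambda_form l\<close> depends on the vector \<open>l\<close> spanning the line only up to a nonzero scalar, so
  letting \<open>l\<close> range over all nonzero vectors does not change the ideal that is generated.\<close>

definition arr_ideal :: "(complex ^ 'n::{finite,linorder}) set list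
    \<Rightarrow> 'n superspace set" where
  "arr_ideal A = genideal ring_of_type_algebra
    (\<Union>l\<in>- {0}. let g = lambda_form l ^ (rho A (line_through l) + 1) in {g, euler g})"

definition arr_quotient :: "(complex ^ 'n::{finite,linorder}) set list
    \<Rightarrow> 'n superspace set ring" where
  "arr_quotient A = ring_of_type_algebra Quot arr_ideal A"

lemma ring_arr_quotient: "ring (arr_quotient A)"
proof -
  interpret ring "ring_of_type_algebra :: 'a superspace ring" by (rule ring_superspace)
  have "ideal (arr_ideal A) ring_of_type_algebra"
    unfolding arr_ideal_def by (rule genideal_ideal) (auto simp: ring_of_type_algebra_def)
  then show ?thesis
    unfolding arr_quotient_def by (rule ideal.quotient_is_ring)
qed

definition arr_proj :: "(complex ^ 'n::{finite,linorder}) set list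
    \<Rightarrow> 'n superspace \<Rightarrow> 'n superspace set" where
  "arr_proj A f = arr_ideal A +>\<^bsub>ring_of_type_algebra\<^esub> f"

text \<open>The complex dimension of the bidegree \<open>(i, j)\<close> component of the quotient, the scalars being the
  classes of the constants.\<close>

definition arr_quotient_dim :: "(complex ^ 'n::{finite,linorder}) set list \<Rightarrow> nat \<Rightarrow> nat \<Rightarrow> nat" where
  "arr_quotient_dim A i j =
    ring.dim (arr_quotient A) (arr_proj A ` range super_const) (arr_proj A ` super_part i j)"

text \<open>The bigraded Hilbert series as a polynomial in \<open>t\<close> (outer variable) whose coefficients are
  polynomials in \<open>q\<close> (inner variable).  For a family with infinitely many nonzero dimensions the
  sum is \<open>0\<close> by convention.\<close>

definition Hilb :: "(nat \<Rightarrow> nat \<Rightarrow> nat) \<Rightarrow> int poly poly" where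
  "Hilb d = (\<Sum>(i, j)\<in>{(i, j). d i j \<noteq> 0}.
     Polynomial.monom (Polynomial.monom (int (d i j)) i) j)"


section \<open>Generic affine arrangements and their faces\<close>

text \<open>\<open>G ! i\<close> is the translate of \<open>A ! i\<close>.  The condition on the normals \<open>a i\<close> does not depend on their
  choice.\<close>

definition generic_arrangement :: "(real ^ 'n) set list \<Rightarrow> (real ^ 'n) set list \<Rightarrow> bool" where
  "generic_arrangement A G \<longleftrightarrow>
     length G = length A \<and>
     (\<forall>i<length A. \<exists>v. G ! i = (+) v ` (A ! i)) \<and>
     (\<exists>a :: nat \<Rightarrow> real ^ 'n.
        (\<forall>i<length A. a i \<noteq> 0 \<and> A ! i = {x. a i \<bullet> x = 0}) \<and>
        (\<forall>K\<subseteq>{..<length A}.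
           (\<Inter>i\<in>K. G ! i) \<noteq> {} \<longleftrightarrow> inj_on a K \<and> independent (a ` K)))"

text \<open>The relatively open cell of the point \<open>x\<close>: all points lying on the same side as \<open>x\<close> of every
  hyperplane in \<open>G\<close> (on it, or in the same open half-space).  The faces of the polyhedral complex
  are the closures of these cells.\<close>

definition arr_cell :: "(real ^ 'n) set set \<Rightarrow> real ^ 'n \<Rightarrow> (real ^ 'n) set" where
  "arr_cell G x =
    {y. \<forall>a b. a \<noteq> 0 \<and> {z. a \<bullet> z = b} \<in> G \<longrightarrow> sgn (a \<bullet> y - b) = sgn (a \<bullet> x - b)}"

definition arr_faces :: "(real ^ 'n) set set \<Rightarrow> nat \<Rightarrow> (real ^ 'n) set set" where
  "arr_faces G i = {F. (\<exists>x. F = closure (arr_cell G x)) \<and> aff_dim F = int i}"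

definition face_number :: "(real ^ 'n) set set \<Rightarrow> nat \<Rightarrow> nat" where
  "face_number G i = card (arr_faces G i)"

end

theory Submission
  imports Defs
begin

text \<open>
  Both sides satisfy the same deletion-contraction recursion.  For a nonzero normal \<open>a\<close> the
  derivation \<open>\<partial>\<^sub>a\<close> maps the ideal of the arrangement onto the ideal of the deletion: a multiple of
  \<open>\<lambda>\<^sub>l\<^sup>r\<close> with \<open>a(l) \<noteq> 0\<close> can be integrated to a multiple of \<open>\<lambda>\<^sub>l\<^bsup>r+1\<^esup>\<close>.  If \<open>a(v) = 1\<close>, the kernel of \<open>\<partial>\<^sub>a\<close> is
  \<open>\<Omega>' \<oplus> \<theta>\<^sub>v \<Omega>'\<close>, where \<open>\<Omega>'\<close> is the superspace of the hyperplane of \<open>a\<close>, and it meets the ideal in the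
  corresponding sum of two copies of the ideal of the contraction.  The last point needs the
  description of the ideal as the annihilator of the functionals obtained by applying some
  derivations \<open>\<partial>\<^sub>a\<close> and some contractions \<open>\<iota>\<^sub>b\<close>, for disjoint sets of normals, and evaluating at \<open>0\<close>.
  Hence the quotient is the one of the deletion plus \<open>1 + t\<close> times the one of the contraction.

  On the other side, a cell of a generic arrangement that meets a new generic hyperplane is cut
  into two cells of the same dimension and one of codimension one more; all others are unchanged.
\<close>

subsection \<open>Operators on superspace\<close>

text \<open>The obstacle is the left end of the exact sequence. The ideal of \<open>A\<close> on
  \<open>W\<close> has generators for lines outside a smaller subspace \<open>V\<close>, so it is
  not evident that an element of it lying in the superspace of \<open>V\<close> is generated by
  lines inside \<open>V\<close>; comparing generators gives only the reverse inclusion. The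
  functionals settle this because they are the same for \<open>W\<close> and \<open>V\<close>. The
  derivation preserves fermionic degree and lowers bosonic degree by one, a shift that disappears at
  \<open>q = 1\<close>. On the geometric side the same induction runs over the flats
  \<open>common K\<close>: the zeros of a sign vector count the hyperplanes containing a cell, hence
  by genericity its codimension, which plays the part of the fermionic degree. A loop corresponds to
  a parallel hyperplane that misses the flat.\<close>

lemma super_coeff_add [simp]: "super_coeff (f + g) S = super_coeff f S + super_coeff g S"
  by (simp add: plus_superspace_def)

lemma super_coeff_zero [simp]: "super_coeff 0 S = 0"
  by (simp add: zero_superspace_def)

lemma super_coeff_sum: "super_coeff (sum F N) S = (\<Sum>k\<in>N. super_coeff (F k) S)"
  by (induction N rule: infinite_finite_induct) auto

lemma super_coeff_poly_mult [simp]: "super_coeff (super_poly p * f) S = p * super_coeff f S"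
proof -
  have "super_coeff (super_poly p * f) S = (\<Sum>T\<in>Pow S. if T = {} then p * super_coeff f S else 0)"
    unfolding times_superspace_def super_poly_def super_coeff_Superspace
    by (rule sum.cong) auto
  then show ?thesis by simp
qed

lemma super_poly_comm: "super_poly p * f = f * super_poly p"
proof (rule superspace_eqI)
  fix S
  have "super_coeff (f * super_poly p) S = (\<Sum>T\<in>Pow S. if T = S then p * super_coeff f S else 0)"
    unfolding times_superspace_def super_poly_def super_coeff_Superspace
    by (rule sum.cong) (auto simp: mult_ac)
  then show "super_coeff (super_poly p * f) S = super_coeff (f * super_poly p) S" by simp
qed

lemma super_poly_mult: "super_poly p * super_poly q = super_poly (p * q)"
  by (rule superspace_eqI) (simp add: super_poly_def[of q] super_poly_def[of "p * q"])

lemma super_poly_add: "super_poly p + super_poly q = super_poly (p + q)"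
  by (rule superspace_eqI) (simp add: super_poly_def)

lemma super_const_comm: "super_const c * f = f * super_const c"
  unfolding super_const_def by (rule super_poly_comm)

lemma super_const_comm_left: "f * (super_const c * g) = super_const c * (f * g)"
  by (metis super_const_comm mult.assoc)

lemma super_x_comm: "super_x k * f = f * super_x k"
  unfolding super_x_def by (rule super_poly_comm)

lemma super_const_simps [simp]:
  "super_const 0 = 0" "super_const 1 = 1" "super_const (- 1) = - 1"
  by (rule superspace_eqI; simp add: super_const_def super_poly_def one_superspace_def
      uminus_superspace_def single_uminus; fail)+

lemma super_const_add: "super_const (c + d) = super_const c + super_const d"
  by (simp add: super_const_def super_poly_add single_add)

lemma super_const_mult: "super_const (c * d) = super_const c * super_const d"
  by (simp add: super_const_def super_poly_mult mult_single)

lemma super_const_mult_left: "super_const c * (super_const d * f) = super_const (c * d) * f"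
  by (simp add: super_const_mult mult.assoc)

lemma super_const_sum: "super_const (sum F N) = (\<Sum>k\<in>N. super_const (F k))"
  by (induction N rule: infinite_finite_induct) (auto simp: super_const_add)

lemma super_coeff_const_mult [simp]:
  "super_coeff (super_const c * f) S = Poly_Mapping.single 0 c * super_coeff f S"
  by (simp add: super_const_def)

lemma lookup_single_mult:
  fixes p :: "'n mpoly"
  shows "Poly_Mapping.lookup (Poly_Mapping.single e c * p) m =
    (if \<exists>r. m = e + r then c * Poly_Mapping.lookup p (m - e) else 0)"
proof -
  have *: "(\<Sum>q. Poly_Mapping.lookup p q when m = e + q) =
      (if \<exists>r. m = e + r then Poly_Mapping.lookup p (m - e) else 0)"
  proof (cases "\<exists>r. m = e + r")
    case True
    then obtain r where r: "m = e + r" by auto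
    have "(\<Sum>q. Poly_Mapping.lookup p q when m = e + q) = (\<Sum>q. Poly_Mapping.lookup p q when q = r)"
      by (rule Sum_any.cong) (auto simp: r when_def)
    then show ?thesis by (auto simp: r)
  next
    case False
    then have "(\<Sum>q. Poly_Mapping.lookup p q when m = e + q) = (\<Sum>q::'n \<Rightarrow>\<^sub>0 nat. 0)"
      by (intro Sum_any.cong) (auto simp: when_def)
    then show ?thesis using False by simp
  qed
  have "Poly_Mapping.lookup (Poly_Mapping.single e c * p) m =
    (\<Sum>l. (c * (\<Sum>q. Poly_Mapping.lookup p q when m = e + q)) when l = e)"
    unfolding lookup_mult by (rule Sum_any.cong) (auto simp: lookup_single when_def)
  then show ?thesis by (simp add: *)
qed

lemma lookup_const_mult [simp]:
  "Poly_Mapping.lookup (Poly_Mapping.single 0 c * (p :: 'n mpoly)) m = c * Poly_Mapping.lookup p m"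
  by (simp add: lookup_single_mult)

lemma lookup_x_mult:
  "Poly_Mapping.lookup (Poly_Mapping.single (Poly_Mapping.single k 1) 1 * (p :: 'n mpoly)) m =
    (if Poly_Mapping.lookup m k = 0 then 0
     else Poly_Mapping.lookup p (m - Poly_Mapping.single k 1))"
proof -
  have "(\<exists>r. m = Poly_Mapping.single k 1 + r) \<longleftrightarrow> Poly_Mapping.lookup m k \<noteq> 0"
  proof
    assume "Poly_Mapping.lookup m k \<noteq> 0"
    then have "m = Poly_Mapping.single k 1 + (m - Poly_Mapping.single k 1)"
      by (intro poly_mapping_eqI) (auto simp: lookup_add lookup_minus lookup_single when_def)
    then show "\<exists>r. m = Poly_Mapping.single k 1 + r" ..
  qed (auto simp: lookup_add)
  then show ?thesis by (auto simp: lookup_single_mult)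
qed

text \<open>The truncated subtraction can also send a monomial without \<open>x_i\<close> to
  \<open>m\<close>, but that one carries the factor 0, so only \<open>m\<close> times
  \<open>x_i\<close> contributes.\<close>

lemma lookup_mpoly_pderiv:
  "Poly_Mapping.lookup (mpoly_pderiv i p) m =
    of_nat (Poly_Mapping.lookup m i + 1) * Poly_Mapping.lookup p (m + Poly_Mapping.single i 1)"
proof -
  let ?e = "Poly_Mapping.single i (1::nat)"
  have "Poly_Mapping.lookup (mpoly_pderiv i p) m =
      (\<Sum>r\<in>Poly_Mapping.keys p. if r = m + ?e then
        of_nat (Poly_Mapping.lookup m i + 1) * Poly_Mapping.lookup p (m + ?e) else 0)"
    unfolding mpoly_pderiv_def lookup_sum
  proof (rule sum.cong[OF refl])
    fix r assume "r \<in> Poly_Mapping.keys p"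
    have *: "r = m + ?e" if "r - ?e = m" "Poly_Mapping.lookup r i \<noteq> 0"
      unfolding that(1)[symmetric] using that(2)
      by (intro poly_mapping_eqI) (auto simp: lookup_add lookup_minus lookup_single when_def)
    show "Poly_Mapping.lookup (Poly_Mapping.single (r - ?e)
        (of_nat (Poly_Mapping.lookup r i) * Poly_Mapping.lookup p r)) m =
      (if r = m + ?e then
        of_nat (Poly_Mapping.lookup m i + 1) * Poly_Mapping.lookup p (m + ?e) else 0)"
    proof (cases "r = m + ?e")
      case True
      then show ?thesis by (simp add: lookup_add)
    next
      case False
      then show ?thesis using * by (auto simp: lookup_single when_def)
    qed
  qed
  then show ?thesis by (simp add: in_keys_iff)
qed

section \<open>Linear operators on superspace: derivatives and contractions\<close>

definition linear_op :: "('n::{finite,linorder} superspace \<Rightarrow> 'n superspace) \<Rightarrow> bool" where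
  "linear_op F \<longleftrightarrow> (\<forall>f g. F (f + g) = F f + F g) \<and> (\<forall>c f. F (super_const c * f) = super_const c * F f)"

lemma linear_op_add: "linear_op F \<Longrightarrow> F (f + g) = F f + F g"
  and linear_op_const: "linear_op F \<Longrightarrow> F (super_const c * f) = super_const c * F f"
  by (auto simp: linear_op_def)

lemma linear_op_zero: "linear_op F \<Longrightarrow> F 0 = 0"
  using linear_op_const[of F 0 0] by simp

lemma linear_op_uminus: "linear_op F \<Longrightarrow> F (- f) = - F f"
  using linear_op_const[of F "- 1" f] by simp

lemma linear_op_diff: "linear_op F \<Longrightarrow> F (f - g) = F f - F g"
  using linear_op_add[of F f "- g"] by (simp add: linear_op_uminus)

lemma linear_op_sum: "linear_op F \<Longrightarrow> F (sum h N) = (\<Sum>k\<in>N. F (h k))"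
  by (induction N rule: infinite_finite_induct) (auto simp: linear_op_zero linear_op_add)

lemma linear_op_mult: "linear_op ((*) f)"
  by (auto simp: linear_op_def distrib_left super_const_comm_left)

lemma linear_op_sum_const:
  "(\<And>k. linear_op (F k)) \<Longrightarrow> linear_op (\<lambda>f. \<Sum>k\<in>N. super_const (a k) * F k f)"
  by (auto simp: linear_op_def distrib_left sum.distrib sum_distrib_left super_const_mult_left mult.commute)

lemma linear_op_pderiv: "linear_op (super_pderiv i)"
  unfolding linear_op_def super_pderiv_def
  by (auto intro!: superspace_eqI poly_mapping_eqI simp: lookup_mpoly_pderiv lookup_add ring_distribs)

lemma super_pderiv_x_mult:
  "super_pderiv i (super_x k * f) = (if i = k then f else 0) + super_x k * super_pderiv i f"
proof -
  have "(m + Poly_Mapping.single i 1) - Poly_Mapping.single k 1 =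
      (m - Poly_Mapping.single k 1) + Poly_Mapping.single i 1"
    if "Poly_Mapping.lookup m k \<noteq> 0" for m :: "'a \<Rightarrow>\<^sub>0 nat"
    using that by (intro poly_mapping_eqI) (auto simp: lookup_add lookup_minus lookup_single when_def)
  then show ?thesis
    by (intro superspace_eqI poly_mapping_eqI)
      (auto simp: super_pderiv_def lookup_mpoly_pderiv super_x_def lookup_x_mult[unfolded One_nat_def] lookup_add
        lookup_minus lookup_single ring_distribs when_def)
qed

text \<open>The sign of moving a factor \<open>theta_k\<close> from the front to its sorted position
  among the variables of \<open>S\<close>.\<close>

definition theta_sign :: "'n::linorder \<Rightarrow> 'n set \<Rightarrow> 'n mpoly" where
  "theta_sign k S = (- 1) ^ card {t \<in> S. t < k}"

lemma theta_sign_square [simp]: "theta_sign k S * theta_sign k S = 1"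
  "theta_sign k S * (theta_sign k S * p) = p"
  by (simp_all add: theta_sign_def power_add[symmetric] mult.assoc[symmetric] flip: mult_2)

lemma theta_sign_insert:
  fixes S :: "'n::{finite,linorder} set"
  assumes "i \<notin> S"
  shows "theta_sign k (insert i S) = (if i < k then - theta_sign k S else theta_sign k S)"
proof -
  have "{t \<in> insert i S. t < k} = (if i < k then insert i {t \<in> S. t < k} else {t \<in> S. t < k})"
    by auto
  then show ?thesis using assms by (simp add: theta_sign_def)
qed

lemma theta_sign_remove_self [simp]: "theta_sign k (S - {k}) = theta_sign k S"
  by (auto simp: theta_sign_def intro!: arg_cong[where f = "\<lambda>N. (- 1) ^ card N"])

lemma super_coeff_theta_mult:
  "super_coeff (super_theta k * f) S =
    (if k \<in> S then theta_sign k S * super_coeff f (S - {k}) else 0)"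
proof -
  have "super_coeff (super_theta k * f) S = (\<Sum>T\<in>Pow S. if T = {k} then
      wedge_sign {k} (S - {k}) * super_coeff f (S - {k}) else 0)"
    unfolding times_superspace_def super_theta_def super_coeff_Superspace
    by (rule sum.cong) auto
  moreover have "{(s, t). s \<in> {k} \<and> t \<in> S - {k} \<and> t < s} = Pair k ` {t \<in> S. t < k}"
    by auto
  then have "wedge_sign {k} (S - {k}) = theta_sign k S"
    by (simp add: wedge_sign_def theta_sign_def card_image inj_on_def)
  ultimately show ?thesis by simp
qed

text \<open>The interior product, that is, the left derivative with respect to
  \<open>theta_i\<close>: the sign brings \<open>theta_i\<close> to the front of the sorted product
  before it is removed.\<close>

definition super_contract :: "'n::{finite,linorder} \<Rightarrow> 'n superspace \<Rightarrow> 'n superspace" where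
  "super_contract i f =
    Superspace (\<lambda>S. if i \<in> S then 0 else theta_sign i S * super_coeff f (insert i S))"

lemma linear_op_super_contract: "linear_op (super_contract i)"
  unfolding linear_op_def super_contract_def
  by (auto intro!: superspace_eqI simp: algebra_simps)

lemma super_contract_x_mult: "super_contract i (super_x k * f) = super_x k * super_contract i f"
  by (rule superspace_eqI) (simp add: super_contract_def super_x_def mult_ac)

lemma super_contract_theta_mult:
  "super_contract i (super_theta k * f) = (if i = k then f else 0) - super_theta k * super_contract i f"
proof -
  have "super_coeff (super_contract i (super_theta k * f)) S
      + super_coeff (super_theta k * super_contract i f) S = super_coeff (if i = k then f else 0) S" for S
  proof (cases "i = k")
    case True
    have "theta_sign k (insert k S) = theta_sign k S" if "k \<notin> S"
      using theta_sign_insert[OF that, of k] by simp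
    then show ?thesis using True
      by (auto simp: super_contract_def super_coeff_theta_mult insert_absorb)
  next
    case False
    show ?thesis
    proof (cases "k \<in> S \<and> i \<notin> S")
      case True
      have 1: "theta_sign i S = (if k < i then - theta_sign i (S - {k}) else theta_sign i (S - {k}))"
        using theta_sign_insert[of k "S - {k}" i] True by (auto simp: insert_absorb)
      have 2: "theta_sign k (insert i S) = (if i < k then - theta_sign k S else theta_sign k S)"
        using theta_sign_insert[of i S k] True by auto
      have 3: "insert i S - {k} = insert i (S - {k})" using False by auto
      have "super_coeff (super_contract i (super_theta k * f)) S =
          theta_sign i S * (theta_sign k (insert i S) * super_coeff f (insert i (S - {k})))"
        using True by (simp add: super_contract_def super_coeff_theta_mult 3)
      moreover have "super_coeff (super_theta k * super_contract i f) S =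
          theta_sign k S * (theta_sign i (S - {k}) * super_coeff f (insert i (S - {k})))"
        using True by (simp add: super_contract_def super_coeff_theta_mult)
      \<comment> \<open>Exactly one of \<open>i\<close> and \<open>k\<close> is the smaller one, so
        exactly one of the rewritings \<open>1\<close> and \<open>2\<close> changes a sign, and the
        two products are opposite.\<close>
      moreover have "theta_sign i S * (theta_sign k (insert i S) * p) + theta_sign k S * (theta_sign i (S - {k}) * p) = 0" for p
      proof -
        consider "i < k" "\<not> k < i" | "k < i" "\<not> i < k"
          using False by (cases i k rule: linorder_cases) auto
        then show ?thesis
          unfolding 1 2
          by cases (simp_all only: if_True if_False mult_minus_left mult_minus_right
            mult.left_commute add.left_inverse add.right_inverse simp_thms)
      qed
      ultimately show ?thesis using False by simp
    qed (use False in \<open>auto simp: super_contract_def super_coeff_theta_mult\<close>)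
  qed
  then show ?thesis
    by (intro superspace_eqI) (simp add: minus_superspace_def algebra_simps eq_diff_eq)
qed

lemma super_theta_anticomm: "super_theta i * super_theta k = - (super_theta k * super_theta i)"
proof -
  have "super_coeff (super_theta i * super_theta k) S + super_coeff (super_theta k * super_theta i) S = 0" for S
  proof (cases "i \<noteq> k \<and> i \<in> S \<and> k \<in> S")
    case True
    define p where "p = super_coeff (1 :: 'a superspace) (S - {i} - {k})"
    have 1: "theta_sign i S = (if k < i then - theta_sign i (S - {k}) else theta_sign i (S - {k}))"
      using theta_sign_insert[of k "S - {k}" i] True by (auto simp: insert_absorb)
    have 2: "theta_sign k S = (if i < k then - theta_sign k (S - {i}) else theta_sign k (S - {i}))"
      using theta_sign_insert[of i "S - {i}" k] True by (auto simp: insert_absorb)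
    have "super_coeff (super_theta i * (super_theta k * 1)) S = theta_sign i S * (theta_sign k (S - {i}) * p)"
      using True unfolding super_coeff_theta_mult p_def by auto
    moreover have "S - {k} - {i} = S - {i} - {k}" by auto
    then have "super_coeff (super_theta k * (super_theta i * 1)) S = theta_sign k S * (theta_sign i (S - {k}) * p)"
      using True unfolding super_coeff_theta_mult p_def by auto
    moreover have "theta_sign i S * (theta_sign k (S - {i}) * p) + theta_sign k S * (theta_sign i (S - {k}) * p) = 0"
    proof -
      consider "i < k" "\<not> k < i" | "k < i" "\<not> i < k"
        using True by (cases i k rule: linorder_cases) auto
      then show ?thesis
        unfolding 1 2
        by cases (simp_all only: if_True if_False mult_minus_left mult_minus_right
          mult.left_commute add.left_inverse add.right_inverse simp_thms)
    qed
    ultimately show ?thesis by simp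
  next
    case False
    have "super_coeff (super_theta i * (super_theta k * 1)) S = 0"
      "super_coeff (super_theta k * (super_theta i * 1)) S = 0"
      unfolding super_coeff_theta_mult using False by auto
    then show ?thesis by simp
  qed
  then show ?thesis
    by (intro superspace_eqI) (simp add: uminus_superspace_def eq_neg_iff_add_eq_0)
qed

section \<open>Operators attached to vectors, and their commutation rules\<close>

definition pair :: "complex ^ 'n \<Rightarrow> complex ^ 'n \<Rightarrow> complex" where
  "pair a l = (\<Sum>k\<in>UNIV. a $ k * l $ k)"

definition dir_deriv :: "complex ^ 'n::{finite,linorder} \<Rightarrow> 'n superspace \<Rightarrow> 'n superspace" where
  "dir_deriv a f = (\<Sum>k\<in>UNIV. super_const (a $ k) * super_pderiv k f)"

definition contract :: "complex ^ 'n::{finite,linorder} \<Rightarrow> 'n superspace \<Rightarrow> 'n superspace" where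
  "contract a f = (\<Sum>k\<in>UNIV. super_const (a $ k) * super_contract k f)"

definition theta_form :: "complex ^ 'n::{finite,linorder} \<Rightarrow> 'n superspace" where
  "theta_form l = (\<Sum>k\<in>UNIV. super_const (l $ k) * super_theta k)"

lemma linear_op_dir_deriv: "linear_op (dir_deriv a)"
  using linear_op_sum_const[OF linear_op_pderiv, where a = "\<lambda>k. a $ k" and N = UNIV] by (simp add: dir_deriv_def[abs_def])

lemma linear_op_contract: "linear_op (contract a)"
  using linear_op_sum_const[OF linear_op_super_contract, where a = "\<lambda>k. a $ k" and N = UNIV] by (simp add: contract_def[abs_def])

lemma pair_right_simps:
  "pair a 0 = 0" "pair a (u + v) = pair a u + pair a v" "pair a (u - v) = pair a u - pair a v"
  "pair a (c *s v) = c * pair a v"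
  by (simp_all add: pair_def algebra_simps sum.distrib sum_subtractf sum_distrib_left)

lemma form_simps:
  "lambda_form 0 = 0" "theta_form 0 = 0"
  "lambda_form (u + v) = lambda_form u + lambda_form v"
  "theta_form (u + v) = theta_form u + theta_form v"
  "lambda_form (c *s v) = super_const c * lambda_form v"
  "theta_form (c *s v) = super_const c * theta_form v"
  by (simp_all add: lambda_form_def theta_form_def super_const_add super_const_mult algebra_simps
     sum.distrib sum_distrib_left)

lemma lambda_comm: "lambda_form l * f = f * lambda_form l"
  by (simp add: lambda_form_def sum_distrib_left sum_distrib_right super_const_comm_left super_x_comm mult.assoc)

lemma lambda_comm_left: "f * (lambda_form l * g) = lambda_form l * (f * g)"
  by (metis lambda_comm mult.assoc)

lemma lambda_pow_comm_left: "f * (lambda_form l ^ r * g) = lambda_form l ^ r * (f * g)"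
  by (induction r arbitrary: g) (auto simp: mult.assoc lambda_comm_left)

lemma theta_anticomm: "theta_form l * theta_form m = - (theta_form m * theta_form l)"
proof -
  have "theta_form l * theta_form m = (\<Sum>i\<in>UNIV. \<Sum>k\<in>UNIV.
      super_const (l $ i) * (super_const (m $ k) * (super_theta i * super_theta k)))" for l m :: "complex ^ 'a::{finite,linorder}"
    unfolding theta_form_def sum_distrib_right sum_distrib_left
    by (subst sum.swap) (simp add: mult.assoc super_const_comm_left[of "super_theta i" for i])
  note * = this
  have "theta_form l * theta_form m = (\<Sum>i\<in>UNIV. \<Sum>k\<in>UNIV.
      - (super_const (m $ k) * (super_const (l $ i) * (super_theta k * super_theta i))))"
    unfolding * by (intro sum.cong refl, subst super_theta_anticomm)
      (simp add: super_const_mult_left mult.commute)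
  also have "\<dots> = - (theta_form m * theta_form l)"
    unfolding * by (subst sum.swap) (simp add: sum_negf)
  finally show ?thesis .
qed

lemma lambda_mult_expand: "lambda_form l * f = (\<Sum>k\<in>UNIV. super_const (l $ k) * (super_x k * f))"
  by (simp add: lambda_form_def sum_distrib_right mult.assoc)

lemma theta_mult_expand: "theta_form l * f = (\<Sum>k\<in>UNIV. super_const (l $ k) * (super_theta k * f))"
  by (simp add: theta_form_def sum_distrib_right mult.assoc)

lemma super_pderiv_lambda_mult:
  "super_pderiv i (lambda_form l * f) = super_const (l $ i) * f + lambda_form l * super_pderiv i f"
  unfolding lambda_mult_expand linear_op_sum[OF linear_op_pderiv] linear_op_const[OF linear_op_pderiv]
    super_pderiv_x_mult
  by (simp add: distrib_left sum.distrib if_distrib[of "\<lambda>x. c * x" for c] cong: if_cong)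

lemma super_contract_lambda_mult:
  "super_contract i (lambda_form l * f) = lambda_form l * super_contract i f"
  unfolding lambda_mult_expand linear_op_sum[OF linear_op_super_contract] linear_op_const[OF linear_op_super_contract]
    super_contract_x_mult by simp

lemma super_pderiv_theta: "super_pderiv i (super_theta k * f) = super_theta k * super_pderiv i f"
proof -
  have "mpoly_pderiv i (theta_sign k S * p) = theta_sign k S * mpoly_pderiv i p" for S :: "'a set" and p
  proof -
    have "theta_sign k S = 1 \<or> theta_sign k S = - 1" unfolding theta_sign_def
      by (metis minus_one_power_iff)
    then show ?thesis
      by (auto intro!: poly_mapping_eqI simp: lookup_mpoly_pderiv)
  qed
  moreover have "mpoly_pderiv i (0 :: 'a mpoly) = 0" by (simp add: mpoly_pderiv_def)
  ultimately show ?thesis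
    by (intro superspace_eqI) (simp add: super_pderiv_def super_coeff_theta_mult)
qed

lemma super_pderiv_theta_mult:
  "super_pderiv i (theta_form l * f) = theta_form l * super_pderiv i f"
  unfolding theta_mult_expand linear_op_sum[OF linear_op_pderiv] linear_op_const[OF linear_op_pderiv]
    super_pderiv_theta by simp

lemma super_contract_theta_form_mult:
  "super_contract i (theta_form l * f) = super_const (l $ i) * f - theta_form l * super_contract i f"
  unfolding theta_mult_expand linear_op_sum[OF linear_op_super_contract] linear_op_const[OF linear_op_super_contract]
    super_contract_theta_mult
  by (simp add: right_diff_distrib sum_subtractf if_distrib[of "\<lambda>x. c * x" for c] cong: if_cong)

text \<open>A Weyl relation, with a Clifford relation in \<open>contract_theta\<close> as its
  fermionic twin; the mixed pairs in between commute. Together with the values on constants these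
  rules determine both operators on \<open>flat_algebra\<close>.\<close>

lemma dir_deriv_lambda:
  "dir_deriv a (lambda_form l * f) = super_const (pair a l) * f + lambda_form l * dir_deriv a f"
  by (simp add: dir_deriv_def super_pderiv_lambda_mult pair_def distrib_left sum.distrib
     super_const_sum super_const_mult sum_distrib_left sum_distrib_right super_const_comm_left[of "lambda_form l"] mult.assoc)

lemma dir_deriv_theta: "dir_deriv a (theta_form l * f) = theta_form l * dir_deriv a f"
  by (simp add: dir_deriv_def super_pderiv_theta_mult sum_distrib_left super_const_comm_left)

lemma contract_lambda: "contract a (lambda_form l * f) = lambda_form l * contract a f"
  by (simp add: contract_def super_contract_lambda_mult sum_distrib_left super_const_comm_left)

lemma contract_theta:
  "contract a (theta_form l * f) = super_const (pair a l) * f - theta_form l * contract a f"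
  by (simp add: contract_def super_contract_theta_form_mult pair_def right_diff_distrib sum_subtractf
     super_const_sum super_const_mult sum_distrib_left sum_distrib_right super_const_comm_left[of "theta_form l"] mult.assoc)

lemma dir_deriv_const: "dir_deriv a (super_const c) = 0"
proof -
  have "super_pderiv k (super_const c) = 0" for k :: 'a
    by (intro superspace_eqI poly_mapping_eqI)
      (auto simp: super_pderiv_def super_const_def super_poly_def lookup_mpoly_pderiv lookup_single when_def
        dest!: arg_cong[where f = "\<lambda>m. Poly_Mapping.lookup m k"] simp: lookup_add)
  then show ?thesis by (simp add: dir_deriv_def)
qed

lemma contract_const: "contract a (super_const c) = 0"
proof -
  have "super_contract k (super_const c) = 0" for k :: 'a
    by (intro superspace_eqI) (auto simp: super_contract_def super_const_def super_poly_def)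
  then show ?thesis by (simp add: contract_def)
qed

text \<open>Setting every \<open>x_i\<close> and every \<open>theta_i\<close> to 0.\<close>

definition ev0 :: "'n superspace \<Rightarrow> complex" where
  "ev0 f = Poly_Mapping.lookup (super_coeff f {}) 0"

lemma ev0_simps [simp]:
  "ev0 (f + g) = ev0 f + ev0 g" "ev0 (super_const c * f) = c * ev0 f" "ev0 0 = 0"
  "ev0 (super_const c) = c"
     apply (simp_all add: ev0_def lookup_add)
  apply (simp add: super_const_def super_poly_def)
  done

lemma ev0_sum: "ev0 (sum F N) = (\<Sum>k\<in>N. ev0 (F k))"
  by (induction N rule: infinite_finite_induct) auto

lemma ev0_lambda: "ev0 (lambda_form l * f) = 0"
proof -
  have "ev0 (super_x k * f) = 0" for k :: 'a 
    by (simp add: ev0_def super_x_def lookup_x_mult del: One_nat_def)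
  then show ?thesis by (simp add: lambda_mult_expand ev0_sum)
qed

lemma ev0_theta: "ev0 (theta_form l * f) = 0"
proof -
  have "ev0 (super_theta k * f) = 0" for k :: 'a by (simp add: ev0_def super_coeff_theta_mult)
  then show ?thesis by (simp add: theta_mult_expand ev0_sum)
qed

text \<open>Powers of a linear form commute with everything, so moving the \<open>theta_i\<close>
  that \<open>euler\<close> puts on the right to the front costs no sign. The factor
  \<open>Suc r\<close> is a nonzero complex number and does not affect the ideal generated.\<close>

lemma euler_lambda_power:
  "euler (lambda_form l ^ Suc r) = super_const (of_nat (Suc r)) * (theta_form l * lambda_form l ^ r)"
proof -
  have *: "super_pderiv i (lambda_form l ^ Suc r) = super_const (of_nat (Suc r) * l $ i) * lambda_form l ^ r" for i r
  proof (induction r)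
    case 0
    have "super_pderiv i (1 :: 'a superspace) = 0"
      by (intro superspace_eqI poly_mapping_eqI)
        (auto simp: super_pderiv_def one_superspace_def lookup_mpoly_pderiv lookup_one when_def lookup_add
           dest!: arg_cong[where f = "\<lambda>m. Poly_Mapping.lookup m i"])
    then show ?case using super_pderiv_lambda_mult[of i l 1] by simp
  next
    case (Suc r)
    have two: "super_const 2 * f = f + f" for f :: "'a superspace"
      by (metis super_const_add super_const_simps(2) one_add_one mult_1 distrib_right)
    show ?case
      unfolding power_Suc[of _ "Suc r"] super_pderiv_lambda_mult Suc
      by (simp add: super_const_comm_left[of "lambda_form l"] super_const_add super_const_mult
          ring_distribs mult.assoc two)
  qed
  have "super_const (of_nat (Suc r) * l $ i) * lambda_form l ^ r * super_theta i =
    super_const (of_nat (Suc r)) * (super_const (l $ i) * super_theta i) * lambda_form l ^ r" for i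
    using lambda_pow_comm_left[of "super_theta i" l r 1] by (simp add: super_const_mult mult.assoc)
  then show ?thesis
    unfolding euler_def * theta_form_def sum_distrib_left sum_distrib_right
    by (simp add: mult.assoc)
qed

subsection \<open>Flats of an arrangement and their ideals\<close>

text \<open>The superspace of \<open>W\<close>, realised as a subalgebra of the ambient one instead
  of a ring in its own variables. Closure under left multiplication by generators, instead of under
  all products, fits the commutation rules of the operators.\<close>

inductive_set flat_algebra :: "(complex ^ 'n::{finite,linorder}) set \<Rightarrow> 'n superspace set"
  for W where
    const: "super_const c \<in> flat_algebra W"
  | add: "f \<in> flat_algebra W \<Longrightarrow> g \<in> flat_algebra W \<Longrightarrow> f + g \<in> flat_algebra W"
  | lambda: "l \<in> W \<Longrightarrow> f \<in> flat_algebra W \<Longrightarrow> lambda_form l * f \<in> flat_algebra W"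
  | theta: "l \<in> W \<Longrightarrow> f \<in> flat_algebra W \<Longrightarrow> theta_form l * f \<in> flat_algebra W"

lemma flat_algebra_zero [simp]: "0 \<in> flat_algebra W"
  using flat_algebra.const[of 0] by simp

lemma flat_algebra_const_mult: "f \<in> flat_algebra W \<Longrightarrow> super_const c * f \<in> flat_algebra W"
  by (induction rule: flat_algebra.induct)
    (auto simp: super_const_mult[symmetric] distrib_left super_const_comm_left[symmetric]
      intro: flat_algebra.intros)

lemma flat_algebra_uminus: "f \<in> flat_algebra W \<Longrightarrow> - f \<in> flat_algebra W"
  using flat_algebra_const_mult[of f W "- 1"] by simp

lemma flat_algebra_diff: "f \<in> flat_algebra W \<Longrightarrow> g \<in> flat_algebra W \<Longrightarrow> f - g \<in> flat_algebra W"
  using flat_algebra.add[OF _ flat_algebra_uminus, of f W g] by simp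

lemma flat_algebra_sum:
  "(\<And>k. k \<in> N \<Longrightarrow> F k \<in> flat_algebra W) \<Longrightarrow> sum F N \<in> flat_algebra W"
  by (induction N rule: infinite_finite_induct) (auto intro: flat_algebra.add)

lemma flat_algebra_power: "l \<in> W \<Longrightarrow> f \<in> flat_algebra W \<Longrightarrow> lambda_form l ^ r * f \<in> flat_algebra W"
  by (induction r) (auto simp: mult.assoc intro: flat_algebra.lambda)

lemma flat_algebra_mono: "W \<subseteq> V \<Longrightarrow> f \<in> flat_algebra W \<Longrightarrow> f \<in> flat_algebra V"
  by (rotate_tac, induction rule: flat_algebra.induct) (auto intro: flat_algebra.intros)

lemma dir_deriv_closed: "f \<in> flat_algebra W \<Longrightarrow> dir_deriv a f \<in> flat_algebra W"
  by (induction rule: flat_algebra.induct)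
    (auto simp: dir_deriv_const linear_op_add[OF linear_op_dir_deriv] dir_deriv_lambda dir_deriv_theta
      intro: flat_algebra.intros flat_algebra_const_mult)

lemma contract_closed: "f \<in> flat_algebra W \<Longrightarrow> contract a f \<in> flat_algebra W"
  by (induction rule: flat_algebra.induct)
    (auto simp: contract_const linear_op_add[OF linear_op_contract] contract_lambda contract_theta
      intro: flat_algebra.intros flat_algebra_const_mult flat_algebra_diff)

lemma dir_deriv_vanish:
  "f \<in> flat_algebra W \<Longrightarrow> (\<And>l. l \<in> W \<Longrightarrow> pair a l = 0) \<Longrightarrow> dir_deriv a f = 0"
  by (induction rule: flat_algebra.induct)
    (auto simp: dir_deriv_const linear_op_add[OF linear_op_dir_deriv] dir_deriv_lambda dir_deriv_theta)

lemma contract_vanish: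
  "f \<in> flat_algebra W \<Longrightarrow> (\<And>l. l \<in> W \<Longrightarrow> pair a l = 0) \<Longrightarrow> contract a f = 0"
  by (induction rule: flat_algebra.induct)
    (auto simp: contract_const linear_op_add[OF linear_op_contract] contract_lambda contract_theta)

definition super_monom :: "'n set \<Rightarrow> ('n \<Rightarrow>\<^sub>0 nat) \<Rightarrow> complex \<Rightarrow> 'n superspace" where
  "super_monom S m c = Superspace (\<lambda>T. if T = S then Poly_Mapping.single m c else 0)"

lemma lambda_form_axis: "lambda_form (axis k 1) = super_x k"
  and theta_form_axis: "theta_form (axis k 1) = super_theta k"
proof -
  have "lambda_form (axis k 1) = (\<Sum>i\<in>UNIV. if i = k then super_x k else 0)"
    unfolding lambda_form_def by (rule sum.cong) (auto simp: axis_def)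
  then show "lambda_form (axis k 1) = super_x k" by simp
  have "theta_form (axis k 1) = (\<Sum>i\<in>UNIV. if i = k then super_theta k else 0)"
    unfolding theta_form_def by (rule sum.cong) (auto simp: axis_def)
  then show "theta_form (axis k 1) = super_theta k" by simp
qed

text \<open>The outer induction on the bosonic degree peels off one \<open>x_k\<close> at a time; in
  degree 0 an induction on \<open>S\<close> peels off the \<open>theta_k\<close>.\<close>

lemma super_monom_in_flat_algebra: "super_monom S m c \<in> flat_algebra UNIV"
proof (induction "\<Sum>k\<in>UNIV. Poly_Mapping.lookup m k" arbitrary: m)
  case 0
  then have m: "m = 0" by (intro poly_mapping_eqI) simp
  have "finite S" by simp
  then show ?case unfolding m
  proof (induction S arbitrary: c)
    case empty
    have "(super_monom {} 0 c :: 'a superspace) = super_const c"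
      by (intro superspace_eqI) (simp add: super_monom_def super_const_def super_poly_def)
    then show ?case by (simp add: flat_algebra.const)
  next
    case (insert k S)
    \<comment> \<open>The sign is turned into a complex scalar \<open>e\<close> so that the
      coefficient can absorb it; \<open>e * e = 1\<close> cancels it again.\<close>
    have "theta_sign k (insert k S) = 1 \<or> theta_sign k (insert k S) = - 1"
      unfolding theta_sign_def by (metis minus_one_power_iff)
    then obtain e where e: "theta_sign k (insert k S) = Poly_Mapping.single 0 e" "e * e = (1::complex)"
    proof
      assume "theta_sign k (insert k S) = 1"
      then show ?thesis using that[of 1] by simp
    next
      assume "theta_sign k (insert k S) = - 1"
      then show ?thesis using that[of "- 1"] by (simp add: single_uminus)
    qed
    have "super_monom (insert k S) 0 c = super_theta k * super_monom S 0 (e * c)"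
    proof (rule superspace_eqI)
      fix T
      show "super_coeff (super_monom (insert k S) 0 c) T = super_coeff (super_theta k * super_monom S 0 (e * c)) T"
      proof (cases "T = insert k S")
        case True
        then show ?thesis using insert(2) e
          by (simp add: super_coeff_theta_mult super_monom_def mult_single mult.assoc[symmetric])
      next
        case False
        then have "k \<in> T \<Longrightarrow> T - {k} \<noteq> S" by auto
        then show ?thesis using False
          by (auto simp: super_coeff_theta_mult super_monom_def)
      qed
    qed
    then show ?case
      using flat_algebra.theta[OF UNIV_I insert(3), of "axis k 1"] by (simp add: theta_form_axis)
  qed
next
  case (Suc d)
  then obtain k where k: "Poly_Mapping.lookup m k \<noteq> 0"
    by (metis sum.neutral nat.distinct(1))
  let ?r = "m - Poly_Mapping.single k 1"
  have m: "m = Poly_Mapping.single k 1 + ?r"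
    using k by (intro poly_mapping_eqI) (auto simp: lookup_add lookup_minus lookup_single when_def)
  have "(\<Sum>j\<in>UNIV. Poly_Mapping.lookup m j) = (\<Sum>j\<in>UNIV. (if j = k then 1 else 0) + Poly_Mapping.lookup ?r j)"
    by (subst m) (auto simp: lookup_add lookup_single when_def intro!: sum.cong)
  also have "\<dots> = Suc (\<Sum>j\<in>UNIV. Poly_Mapping.lookup ?r j)"
    by (simp add: sum.distrib)
  finally have IH: "super_monom S ?r c \<in> flat_algebra UNIV"
    using Suc(2) by (intro Suc(1)) simp
  have "super_monom S m c = super_x k * super_monom S ?r c"
  proof (rule superspace_eqI)
    fix T
    have "Poly_Mapping.single m c = Poly_Mapping.single (Poly_Mapping.single k 1) 1 * Poly_Mapping.single ?r c"
      using m by (simp add: mult_single)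
    then show "super_coeff (super_monom S m c) T = super_coeff (super_x k * super_monom S ?r c) T"
      by (simp add: super_monom_def super_x_def)
  qed
  then show ?case
    using flat_algebra.lambda[OF UNIV_I IH, of "axis k 1"] by (simp add: lambda_form_axis)
qed

lemma flat_algebra_UNIV [simp]: "f \<in> flat_algebra UNIV"
proof -
  have "f = (\<Sum>S\<in>UNIV. \<Sum>m\<in>Poly_Mapping.keys (super_coeff f S). super_monom S m (Poly_Mapping.lookup (super_coeff f S) m))"
    (is "f = ?g")
  proof (rule superspace_eqI)
    fix T
    have "super_coeff ?g T = (\<Sum>S\<in>UNIV. if S = T then
        (\<Sum>m\<in>Poly_Mapping.keys (super_coeff f T). Poly_Mapping.single m (Poly_Mapping.lookup (super_coeff f T) m)) else 0)"
      unfolding super_coeff_sum by (rule sum.cong) (auto simp: super_monom_def)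
    also have "\<dots> = super_coeff f T"
      by (simp, intro poly_mapping_eqI)
        (auto simp: lookup_sum lookup_single when_def in_keys_iff)
    finally show "super_coeff f T = super_coeff ?g T" by simp
  qed
  then show ?thesis
    by (metis (no_types, lifting) flat_algebra_sum super_monom_in_flat_algebra)
qed

definition mult_off :: "(complex ^ 'n) list \<Rightarrow> complex ^ 'n \<Rightarrow> nat" where
  "mult_off A l = length (filter (\<lambda>a. pair a l \<noteq> 0) A)"

text \<open>The right ideal of \<open>flat_algebra W\<close> generated by the same kind of powers and differentials as
  \<open>arr_ideal\<close>, for the arrangement with normals \<open>A\<close> and for the lines contained in \<open>W\<close> only.\<close>

inductive_set flat_ideal ::
    "(complex ^ 'n::{finite,linorder}) list \<Rightarrow> (complex ^ 'n::{finite,linorder}) set \<Rightarrow> 'n superspace set"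
  for A W where
    zero: "0 \<in> flat_ideal A W"
  | add: "f \<in> flat_ideal A W \<Longrightarrow> g \<in> flat_ideal A W \<Longrightarrow> f + g \<in> flat_ideal A W"
  | lambda: "l \<in> W \<Longrightarrow> g \<in> flat_algebra W \<Longrightarrow> lambda_form l ^ Suc (mult_off A l) * g \<in> flat_ideal A W"
  | theta: "l \<in> W \<Longrightarrow> g \<in> flat_algebra W \<Longrightarrow> theta_form l * (lambda_form l ^ mult_off A l * g) \<in> flat_ideal A W"

lemma flat_ideal_subset: "f \<in> flat_ideal A W \<Longrightarrow> f \<in> flat_algebra W"
  by (induction rule: flat_ideal.induct)
    (auto simp del: power_Suc intro: flat_algebra.intros flat_algebra_power)

lemma flat_ideal_const_mult: "f \<in> flat_ideal A W \<Longrightarrow> super_const c * f \<in> flat_ideal A W"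
proof (induction rule: flat_ideal.induct)
  case (add f g) then show ?case by (simp add: distrib_left flat_ideal.add)
next
  case (lambda l g)
  then show ?case
    unfolding super_const_comm_left[symmetric] by (intro flat_ideal.lambda flat_algebra_const_mult)
next
  case (theta l g)
  then show ?case
    unfolding super_const_comm_left[symmetric] by (intro flat_ideal.theta flat_algebra_const_mult)
qed (simp add: flat_ideal.zero)

lemma flat_ideal_uminus: "f \<in> flat_ideal A W \<Longrightarrow> - f \<in> flat_ideal A W"
  using flat_ideal_const_mult[of f A W "- 1"] by simp

lemma flat_ideal_diff: "f \<in> flat_ideal A W \<Longrightarrow> g \<in> flat_ideal A W \<Longrightarrow> f - g \<in> flat_ideal A W"
  using flat_ideal.add[OF _ flat_ideal_uminus, of f A W g] by simp

text \<open>With \<open>flat_ideal_theta_mult\<close> this makes the right ideal two-sided inside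
  \<open>flat_algebra W\<close>: linear forms are central, and a theta factor passes the generators
  up to sign.\<close>

lemma flat_ideal_lambda_mult: "l \<in> W \<Longrightarrow> f \<in> flat_ideal A W \<Longrightarrow> lambda_form l * f \<in> flat_ideal A W"
proof (rotate_tac, induction rule: flat_ideal.induct)
  case (add f g) then show ?case by (simp add: distrib_left flat_ideal.add)
next
  case (lambda m g)
  then show ?case
    unfolding lambda_pow_comm_left[of "lambda_form l"]
    by (intro flat_ideal.lambda flat_algebra.lambda)
next
  case (theta m g)
  then have "theta_form m * (lambda_form m ^ mult_off A m * (lambda_form l * g)) \<in> flat_ideal A W"
    by (intro flat_ideal.theta flat_algebra.lambda)
  then show ?case by (simp add: lambda_comm_left)
qed (simp add: flat_ideal.zero)

lemma flat_ideal_theta_mult: "l \<in> W \<Longrightarrow> f \<in> flat_ideal A W \<Longrightarrow> theta_form l * f \<in> flat_ideal A W"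
proof (rotate_tac, induction rule: flat_ideal.induct)
  case (add f g) then show ?case by (simp add: distrib_left flat_ideal.add)
next
  case (lambda m g)
  then show ?case
    unfolding lambda_pow_comm_left[of "theta_form l"]
    by (intro flat_ideal.lambda flat_algebra.theta)
next
  case (theta m g)
  \<comment> \<open>Passing \<open>theta_form l\<close> over \<open>theta_form m\<close> costs a
    sign, which is placed in the cofactor.\<close>
  then have "theta_form m * (lambda_form m ^ mult_off A m * - (theta_form l * g)) \<in> flat_ideal A W"
    by (intro flat_ideal.theta flat_algebra_uminus flat_algebra.theta)
  also have "theta_form m * (lambda_form m ^ mult_off A m * - (theta_form l * g)) =
      theta_form l * (theta_form m * (lambda_form m ^ mult_off A m * g))"
  proof -
    have "theta_form m * (lambda_form m ^ mult_off A m * - (theta_form l * g)) =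
        - (theta_form m * theta_form l * (lambda_form m ^ mult_off A m * g))"
      by (simp add: lambda_pow_comm_left[of "theta_form l", symmetric] mult.assoc)
    also have "\<dots> = theta_form l * theta_form m * (lambda_form m ^ mult_off A m * g)"
      by (subst theta_anticomm) simp
    finally show ?thesis by (simp add: mult.assoc)
  qed
  finally show ?case .
qed (simp add: flat_ideal.zero)

text \<open>A generator with a larger exponent is a multiple of the one with the smaller exponent.
  Only lines in \<open>W\<close> enter the comparison, so \<open>B\<close> may contain further
  normals that vanish on \<open>W\<close>.\<close>

lemma flat_ideal_mono:
  assumes "W \<subseteq> V" "\<And>l. l \<in> W \<Longrightarrow> mult_off B l \<le> mult_off A l" "f \<in> flat_ideal A W"
  shows "f \<in> flat_ideal B V"
  using assms(3)
proof (induction rule: flat_ideal.induct)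
  case (lambda l g)
  then have "lambda_form l ^ Suc (mult_off B l) *
      (lambda_form l ^ (mult_off A l - mult_off B l) * g) \<in> flat_ideal B V"
    using assms(1) by (intro flat_ideal.lambda flat_algebra_power flat_algebra_mono[OF assms(1)]) auto
  moreover have "Suc (mult_off B l) + (mult_off A l - mult_off B l) = Suc (mult_off A l)"
    using assms(2)[OF lambda(1)] by simp
  ultimately show ?case
    by (simp only: mult.assoc[symmetric] power_add[symmetric])
next
  case (theta l g)
  then have "theta_form l * (lambda_form l ^ mult_off B l *
      (lambda_form l ^ (mult_off A l - mult_off B l) * g)) \<in> flat_ideal B V"
    using assms(1) by (intro flat_ideal.theta flat_algebra_power flat_algebra_mono[OF assms(1)]) auto
  moreover have "mult_off B l + (mult_off A l - mult_off B l) = mult_off A l"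
    using assms(2)[OF theta(1)] by simp
  ultimately show ?case
    by (simp only: mult.assoc[of "lambda_form l ^ m" for m, symmetric] power_add[symmetric])
qed (auto intro: flat_ideal.intros)

lemma dir_deriv_lambda_power:
  "dir_deriv a (lambda_form l ^ Suc r * f) =
    lambda_form l ^ r * (super_const (of_nat (Suc r) * pair a l) * f) + lambda_form l ^ Suc r * dir_deriv a f"
proof (induction r)
  case 0
  then show ?case by (simp add: dir_deriv_lambda)
next
  case (Suc r)
  have "dir_deriv a (lambda_form l ^ Suc (Suc r) * f) =
    super_const (pair a l) * (lambda_form l ^ Suc r * f) + lambda_form l * dir_deriv a (lambda_form l ^ Suc r * f)"
    unfolding power_Suc[of _ "Suc r"] mult.assoc by (rule dir_deriv_lambda)
  also have "\<dots> = super_const (pair a l) * (lambda_form l ^ Suc r * f) +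
     super_const (of_nat (Suc r) * pair a l) * (lambda_form l ^ Suc r * f) + lambda_form l ^ Suc (Suc r) * dir_deriv a f"
    unfolding Suc by (simp add: distrib_left mult.assoc super_const_comm_left[of "lambda_form l"] super_const_comm_left[of "lambda_form l ^ r"])
  also have "\<dots> = super_const (of_nat (Suc (Suc r)) * pair a l) * (lambda_form l ^ Suc r * f) + lambda_form l ^ Suc (Suc r) * dir_deriv a f"
    unfolding distrib_right[symmetric] super_const_add[symmetric] by (simp add: algebra_simps)
  finally show ?case by (simp only: super_const_comm_left)
qed

lemma contract_lambda_power: "contract a (lambda_form l ^ r * f) = lambda_form l ^ r * contract a f"
  by (induction r) (auto simp: mult.assoc contract_lambda)

lemma flat_ideal_delete: "f \<in> flat_ideal (a # A) W \<Longrightarrow> f \<in> flat_ideal A W"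
  by (erule flat_ideal_mono[rotated 2]) (auto simp: mult_off_def)

text \<open>If \<open>pair a l\<close> is nonzero, deleting \<open>a\<close> lowers the exponent of
  \<open>l\<close> by one, which is what differentiating the power costs. If it is zero, the
  derivation passes over the power and only hits the cofactor.\<close>

lemma flat_ideal_dir_deriv: "f \<in> flat_ideal (a # A) W \<Longrightarrow> dir_deriv a f \<in> flat_ideal A W"
proof (induction rule: flat_ideal.induct)
  case zero
  then show ?case by (simp add: linear_op_zero[OF linear_op_dir_deriv] flat_ideal.zero)
next
  case (add f g)
  then show ?case by (simp add: linear_op_add[OF linear_op_dir_deriv] flat_ideal.add)
next
  case (lambda l g)
  have 1: "lambda_form l ^ Suc (mult_off A l) * h \<in> flat_ideal A W" if "h \<in> flat_algebra W" for h
    using lambda that by (intro flat_ideal.lambda)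
  have 2: "lambda_form l ^ Suc (mult_off (a # A) l) * h \<in> flat_ideal A W" if "h \<in> flat_algebra W" for h
    using flat_ideal.lambda[OF lambda(1) that] by (rule flat_ideal_delete)
  show ?case
    unfolding dir_deriv_lambda_power using 1 2 lambda
    by (cases "pair a l = 0")
      (auto simp: mult_off_def simp del: power_Suc intro!: flat_ideal.add flat_algebra_const_mult dir_deriv_closed)
next
  case (theta l g)
  have 2: "theta_form l * (lambda_form l ^ mult_off (a # A) l * h) \<in> flat_ideal A W" if "h \<in> flat_algebra W" for h
    using flat_ideal.theta[OF theta(1) that] by (rule flat_ideal_delete)
  show ?case
  proof (cases "pair a l = 0")
    case True
    then have "dir_deriv a (lambda_form l ^ r * g) = lambda_form l ^ r * dir_deriv a g" for r
      by (cases r) (auto simp: dir_deriv_lambda_power simp del: power_Suc)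
    then show ?thesis using 2 theta(2) by (simp add: dir_deriv_theta dir_deriv_closed)
  next
    case False
    then have eq: "mult_off (a # A) l = Suc (mult_off A l)" by (simp add: mult_off_def)
    show ?thesis
      unfolding dir_deriv_theta eq dir_deriv_lambda_power distrib_left
      using 2[OF dir_deriv_closed[OF theta(2)], of a] theta unfolding eq
      by (intro flat_ideal.add flat_ideal.theta flat_algebra_const_mult)
  qed
qed

text \<open>Contracting a theta generator leaves the bare power with coefficient
  \<open>pair a l\<close>. When this coefficient is nonzero, the exponent is one more than
  \<open>mult_off A l\<close>, just what the power generator of the deletion needs.\<close>

lemma flat_ideal_contract: "f \<in> flat_ideal (a # A) W \<Longrightarrow> contract a f \<in> flat_ideal A W"
proof (induction rule: flat_ideal.induct)
  case zero
  then show ?case by (simp add: linear_op_zero[OF linear_op_contract] flat_ideal.zero)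
next
  case (add f g)
  then show ?case by (simp add: linear_op_add[OF linear_op_contract] flat_ideal.add)
next
  case (lambda l g)
  show ?case
    unfolding contract_lambda_power
    using flat_ideal.lambda[OF lambda(1) contract_closed[OF lambda(2)]] by (rule flat_ideal_delete)
next
  case (theta l g)
  have 2: "theta_form l * (lambda_form l ^ mult_off (a # A) l * contract a g) \<in> flat_ideal A W"
    using flat_ideal.theta[OF theta(1) contract_closed[OF theta(2)]] by (rule flat_ideal_delete)
  show ?case
  proof (cases "pair a l = 0")
    case True
    then show ?thesis using 2 by (simp add: contract_theta contract_lambda_power flat_ideal_uminus)
  next
    case False
    then have eq: "mult_off (a # A) l = Suc (mult_off A l)" by (simp add: mult_off_def)
    show ?thesis
      using 2 theta unfolding contract_theta contract_lambda_power eq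
      by (intro flat_ideal_diff flat_ideal_const_mult flat_ideal.lambda)
  qed
qed

section \<open>Nilpotency of directional derivatives, and integration\<close>

lemma dir_deriv_pow_add: "(dir_deriv a ^^ N) (f + g) = (dir_deriv a ^^ N) f + (dir_deriv a ^^ N) g"
  and dir_deriv_pow_const: "(dir_deriv a ^^ N) (super_const c * f) = super_const c * (dir_deriv a ^^ N) f"
  and dir_deriv_pow_theta: "(dir_deriv a ^^ N) (theta_form l * f) = theta_form l * (dir_deriv a ^^ N) f"
  by (induction N) (auto simp: linear_op_add[OF linear_op_dir_deriv]
      linear_op_const[OF linear_op_dir_deriv] dir_deriv_theta)

lemma dir_deriv_pow_zero: "(dir_deriv a ^^ N) 0 = 0"
  using dir_deriv_pow_const[of N a 0] by simp

lemma dir_deriv_pow_lambda: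
  "(dir_deriv a ^^ N) f = 0 \<Longrightarrow> (dir_deriv a ^^ Suc N) (lambda_form l * f) = 0"
proof (induction N arbitrary: f)
  case 0
  then show ?case by (simp add: linear_op_zero[OF linear_op_dir_deriv])
next
  case (Suc N)
  have "(dir_deriv a ^^ Suc (Suc N)) (lambda_form l * f) =
      (dir_deriv a ^^ Suc N) (super_const (pair a l) * f + lambda_form l * dir_deriv a f)"
    unfolding funpow_Suc_right o_apply dir_deriv_lambda ..
  moreover have "(dir_deriv a ^^ N) (dir_deriv a f) = 0"
    using Suc.prems by (simp only: funpow_Suc_right o_apply)
  ultimately show ?case
    using Suc by (simp only: dir_deriv_pow_add dir_deriv_pow_const mult_zero_right add_0)
qed

text \<open>The order of nilpotency takes the place of a degree: it is the induction measure for
  integration and for the kernel of \<open>dir_deriv a\<close>.\<close>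

lemma dir_deriv_nilpotent: "f \<in> flat_algebra W \<Longrightarrow> \<exists>N. (dir_deriv a ^^ N) f = 0"
proof (induction rule: flat_algebra.induct)
  case (const c)
  then show ?case by (intro exI[of _ 1]) (simp add: dir_deriv_const)
next
  case (add f g)
  then obtain M N where "(dir_deriv a ^^ M) f = 0" "(dir_deriv a ^^ N) g = 0" by auto
  then have "(dir_deriv a ^^ (N + M)) f = 0" "(dir_deriv a ^^ (M + N)) g = 0"
    unfolding funpow_add by (simp_all add: dir_deriv_pow_zero)
  then show ?case by (metis dir_deriv_pow_add add.commute add_0)
next
  case (lambda l f)
  then show ?case using dir_deriv_pow_lambda by blast
next
  case (theta l f)
  then show ?case by (metis dir_deriv_pow_theta mult_zero_right)
qed

lemma super_const_cancel: "c \<noteq> 0 \<Longrightarrow> super_const c * f = 0 \<Longrightarrow> f = 0"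
  using super_const_mult_left[of "inverse c" c f] by simp

lemma super_const_inverse [simp]:
  "c \<noteq> 0 \<Longrightarrow> super_const c * (super_const (inverse c) * f) = f"
  "c \<noteq> 0 \<Longrightarrow> super_const (inverse c) * (super_const c * f) = f"
  by (simp_all add: super_const_mult_left)

text \<open>The product rule reduces the claim to the equation
  \<open>(r + 1) * pair a l * h + lambda_form l * dir_deriv a h = g\<close>. If \<open>h'\<close>
  solves it for \<open>dir_deriv a g\<close> and \<open>r + 1\<close>, then
  \<open>g - lambda_form l * h'\<close> divided by \<open>(r + 1) * pair a l\<close> solves it for
  \<open>g\<close> and \<open>r\<close>. Hence \<open>r\<close> varies in the induction, which ends
  by nilpotency.\<close>

lemma dir_deriv_integrate:
  assumes "l \<in> W" "pair a l \<noteq> 0" "g \<in> flat_algebra W"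
  shows "\<exists>h\<in>flat_algebra W. dir_deriv a (lambda_form l ^ Suc r * h) = lambda_form l ^ r * g"
proof -
  have "\<exists>h\<in>flat_algebra W. super_const (of_nat (Suc r) * pair a l) * h + lambda_form l * dir_deriv a h = g"
    if "(dir_deriv a ^^ N) g = 0" "g \<in> flat_algebra W" for N g r
    using that
  proof (induction N arbitrary: g r)
    case 0
    then show ?case by (intro bexI[of _ 0]) (auto simp: linear_op_zero[OF linear_op_dir_deriv])
  next
    case (Suc N)
    let ?d = "of_nat (Suc r) * pair a l"
    have d: "?d \<noteq> 0" using assms(2) by (metis mult_eq_0_iff of_nat_neq_0)
    have "(dir_deriv a ^^ N) (dir_deriv a g) = 0"
      using Suc.prems(1) by (simp only: funpow_Suc_right o_apply)
    from Suc.IH[OF this dir_deriv_closed[OF Suc.prems(2)], of "Suc r"]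
    obtain h where h: "h \<in> flat_algebra W"
      "super_const (of_nat (Suc (Suc r)) * pair a l) * h + lambda_form l * dir_deriv a h = dir_deriv a g"
      by auto
    let ?k = "super_const (inverse ?d) * (g - lambda_form l * h)"
    have "super_const (of_nat (Suc (Suc r)) * pair a l) * h = super_const ?d * h + super_const (pair a l) * h"
      unfolding distrib_right[symmetric] super_const_add[symmetric] by (simp add: algebra_simps)
    then have "dir_deriv a (g - lambda_form l * h) = super_const ?d * h"
      unfolding linear_op_diff[OF linear_op_dir_deriv] dir_deriv_lambda h(2)[symmetric] by simp
    then have "dir_deriv a ?k = super_const (inverse ?d) * (super_const ?d * h)"
      by (simp only: linear_op_const[OF linear_op_dir_deriv])
    also have "\<dots> = h" using d by (rule super_const_inverse)
    finally have 1: "dir_deriv a ?k = h" .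
    have "super_const ?d * ?k = g - lambda_form l * h"
      using d by (rule super_const_inverse)
    then have "super_const ?d * ?k + lambda_form l * dir_deriv a ?k = g"
      unfolding 1 by simp
    moreover have "?k \<in> flat_algebra W"
      using assms(1) h(1) Suc.prems(2) by (intro flat_algebra_const_mult flat_algebra_diff flat_algebra.lambda)
    ultimately show ?case by blast
  qed
  moreover obtain N where "(dir_deriv a ^^ N) g = 0" using dir_deriv_nilpotent[OF assms(3)] by auto
  ultimately obtain h where h: "h \<in> flat_algebra W"
    "super_const (of_nat (Suc r) * pair a l) * h + lambda_form l * dir_deriv a h = g"
    using assms(3) by metis
  have "dir_deriv a (lambda_form l ^ Suc r * h) = lambda_form l ^ r * g"
    unfolding dir_deriv_lambda_power h(2)[symmetric]
    by (simp only: distrib_left power_Suc2 mult.assoc)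
  then show ?thesis using h(1) by blast
qed

text \<open>If \<open>pair a l\<close> is zero, powers of \<open>lambda_form l\<close> are constants
  for the derivation, and the cofactor alone is integrated, along \<open>v\<close>. Otherwise one
  integrates along \<open>l\<close> itself, which produces exactly the extra factor
  \<open>lambda_form l\<close> that the larger arrangement asks for.\<close>

lemma dir_deriv_flat_ideal_surj:
  assumes "v \<in> W" "pair a v \<noteq> 0" "f \<in> flat_ideal A W"
  shows "\<exists>F\<in>flat_ideal (a # A) W. dir_deriv a F = f"
  using assms(3)
proof (induction rule: flat_ideal.induct)
  case zero
  then show ?case using flat_ideal.zero linear_op_zero[OF linear_op_dir_deriv] by blast
next
  case (add f g)
  then show ?case by (metis flat_ideal.add linear_op_add[OF linear_op_dir_deriv])
next
  case (lambda l g)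
  show ?case
  proof (cases "pair a l = 0")
    case True
    obtain G where G: "G \<in> flat_algebra W" "dir_deriv a G = g"
      using dir_deriv_integrate[OF assms(1,2) lambda(2), of 0] flat_algebra.lambda[OF assms(1)] by auto
    have "dir_deriv a (lambda_form l ^ Suc (mult_off A l) * G) = lambda_form l ^ Suc (mult_off A l) * g"
      unfolding dir_deriv_lambda_power G(2) using True by simp
    moreover have "lambda_form l ^ Suc (mult_off (a # A) l) * G \<in> flat_ideal (a # A) W"
      using lambda(1) G(1) by (rule flat_ideal.lambda)
    moreover have "mult_off (a # A) l = mult_off A l" using True by (simp add: mult_off_def)
    ultimately show ?thesis by metis
  next
    case False
    then have eq: "mult_off (a # A) l = Suc (mult_off A l)" by (simp add: mult_off_def)
    obtain h where h: "h \<in> flat_algebra W"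
      "dir_deriv a (lambda_form l ^ Suc (Suc (mult_off A l)) * h) = lambda_form l ^ Suc (mult_off A l) * g"
      using dir_deriv_integrate[OF lambda(1) False lambda(2), of "Suc (mult_off A l)"] by blast
    then show ?thesis using flat_ideal.lambda[OF lambda(1) h(1), of "a # A"] unfolding eq by blast
  qed
next
  case (theta l g)
  show ?case
  proof (cases "pair a l = 0")
    case True
    obtain G where G: "G \<in> flat_algebra W" "dir_deriv a G = g"
      using dir_deriv_integrate[OF assms(1,2) theta(2), of 0] flat_algebra.lambda[OF assms(1)] by auto
    have "dir_deriv a (lambda_form l ^ r * G) = lambda_form l ^ r * g" for r
      using True G(2) by (cases r) (auto simp: dir_deriv_lambda_power simp del: power_Suc)
    then have "dir_deriv a (theta_form l * (lambda_form l ^ mult_off A l * G)) =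
        theta_form l * (lambda_form l ^ mult_off A l * g)"
      by (simp add: dir_deriv_theta)
    moreover have "theta_form l * (lambda_form l ^ mult_off (a # A) l * G) \<in> flat_ideal (a # A) W"
      using theta(1) G(1) by (rule flat_ideal.theta)
    moreover have "mult_off (a # A) l = mult_off A l" using True by (simp add: mult_off_def)
    ultimately show ?thesis by metis
  next
    case False
    then have eq: "mult_off (a # A) l = Suc (mult_off A l)" by (simp add: mult_off_def)
    obtain h where h: "h \<in> flat_algebra W"
      "dir_deriv a (lambda_form l ^ Suc (mult_off A l) * h) = lambda_form l ^ mult_off A l * g"
      using dir_deriv_integrate[OF theta(1) False theta(2), of "mult_off A l"] by blast
    then have "dir_deriv a (theta_form l * (lambda_form l ^ Suc (mult_off A l) * h)) =
        theta_form l * (lambda_form l ^ mult_off A l * g)"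
      by (simp only: dir_deriv_theta)
    then show ?thesis using flat_ideal.theta[OF theta(1) h(1), of "a # A"] unfolding eq by blast
  qed
qed

section \<open>Splitting the superspace of a subspace along a hyperplane\<close>

lemma theta_form_square: "theta_form l * theta_form l = 0"
proof -
  have "super_const 2 * (theta_form l * theta_form l) = theta_form l * theta_form l + theta_form l * theta_form l"
    by (metis super_const_add super_const_simps(2) one_add_one mult_1 distrib_right)
  also have "\<dots> = 0" using theta_anticomm[of l l] by (metis add.right_inverse)
  finally show ?thesis by (rule super_const_cancel[rotated]) simp
qed

lemma theta_form_square_left: "theta_form l * (theta_form l * f) = 0"
  by (simp add: mult.assoc[symmetric] theta_form_square)

lemma theta_anticomm_left: "theta_form l * (theta_form m * f) = - (theta_form m * (theta_form l * f))"
  by (subst mult.assoc[symmetric], subst theta_anticomm) (simp add: mult.assoc)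

text \<open>A normal \<open>a\<close> that does not vanish on \<open>W\<close>, with a transversal
  vector scaled so that \<open>W\<close> is the direct sum of the kernel of \<open>a\<close> on
  \<open>W\<close> and the line of \<open>v\<close>, with \<open>pair a\<close> as coordinate along
  \<open>v\<close>.\<close>

locale hyperplane_section =
  fixes W :: "(complex ^ 'n::{finite,linorder}) set" and a v :: "complex ^ 'n::{finite,linorder}"
  assumes W: "vec.subspace W" and v: "v \<in> W" "pair a v = 1"
begin

definition "slice = W \<inter> {l. pair a l = 0}"

lemma section_subset: "slice \<subseteq> W"
  by (auto simp: slice_def)

lemma subspace_section: "vec.subspace slice"
  using W unfolding vec.subspace_def slice_def by (auto simp: pair_right_simps)

lemma split_section:
  assumes "l \<in> W" obtains m where "m \<in> slice" "l = m + pair a l *s v"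
proof
  show "l - pair a l *s v \<in> slice"
    using W assms v by (auto simp: slice_def pair_right_simps intro: vec.subspace_diff vec.subspace_scale)
qed simp

text \<open>Division by \<open>lambda_form v\<close>: each generator is split along
  \<open>slice\<close> and \<open>v\<close>, and \<open>theta_form v\<close> occurs at most once in
  the remainder because its square is 0.\<close>

lemma flat_algebra_split:
  assumes "f \<in> flat_algebra W"
  shows "\<exists>u\<in>flat_algebra slice. \<exists>w\<in>flat_algebra slice. \<exists>g\<in>flat_algebra W.
    f = u + theta_form v * w + lambda_form v * g"
  using assms
proof (induction rule: flat_algebra.induct)
  case (const c)
  then show ?case by (intro bexI[of _ "super_const c"] bexI[of _ 0]) (auto intro: flat_algebra.const)
next
  case (add f g)
  then obtain u w h u' w' h' where *: "u \<in> flat_algebra slice" "w \<in> flat_algebra slice" "h \<in> flat_algebra W"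
    "u' \<in> flat_algebra slice" "w' \<in> flat_algebra slice" "h' \<in> flat_algebra W"
    "f = u + theta_form v * w + lambda_form v * h" "g = u' + theta_form v * w' + lambda_form v * h'" by blast
  show ?case
    by (rule bexI[of _ "u + u'"], rule bexI[of _ "w + w'"], rule bexI[of _ "h + h'"])
      (use * in \<open>auto simp: distrib_left intro: flat_algebra.add\<close>)
next
  case (lambda l f)
  then obtain u w h where *: "u \<in> flat_algebra slice" "w \<in> flat_algebra slice" "h \<in> flat_algebra W"
    and f: "f = u + theta_form v * w + lambda_form v * h" by blast
  obtain m where m: "m \<in> slice" "l = m + pair a l *s v" using split_section[OF lambda(1)] .
  have "lambda_form l * f = lambda_form m * f + super_const (pair a l) * (lambda_form v * f)"
    by (subst m(2)) (simp add: form_simps distrib_right mult.assoc)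
  also have "lambda_form m * f = lambda_form m * u + theta_form v * (lambda_form m * w) + lambda_form v * (lambda_form m * h)"
    unfolding f distrib_left lambda_comm_left[of "theta_form v" m w] lambda_comm_left[of "lambda_form m" v h] ..
  finally have "lambda_form l * f = lambda_form m * u + theta_form v * (lambda_form m * w) +
      lambda_form v * (lambda_form m * h + super_const (pair a l) * f)"
    by (simp only: distrib_left super_const_comm_left[of "lambda_form v"] add_ac)
  moreover have "lambda_form m * h + super_const (pair a l) * f \<in> flat_algebra W"
    using m(1) *(3) section_subset lambda(2)
    by (intro flat_algebra.add flat_algebra_const_mult flat_algebra.lambda) auto
  ultimately show ?case using * m(1) by (blast intro: flat_algebra.lambda)
next
  case (theta l f)
  then obtain u w h where *: "u \<in> flat_algebra slice" "w \<in> flat_algebra slice" "h \<in> flat_algebra W"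
    and f: "f = u + theta_form v * w + lambda_form v * h" by blast
  obtain m where m: "m \<in> slice" "l = m + pair a l *s v" using split_section[OF theta(1)] .
  have "theta_form l * (lambda_form v * h) = lambda_form v * (theta_form l * h)"
    by (rule lambda_comm_left)
  moreover have "theta_form l * (u + theta_form v * w) =
      theta_form m * u + theta_form v * (super_const (pair a l) * u - theta_form m * w)"
    by (subst m(2)) (simp add: form_simps distrib_right distrib_left mult.assoc theta_form_square_left
        theta_anticomm_left[of m v] super_const_comm_left[of "theta_form v"] right_diff_distrib)
  ultimately have "theta_form l * f = theta_form m * u +
      theta_form v * (super_const (pair a l) * u - theta_form m * w) + lambda_form v * (theta_form l * h)"
    unfolding f distrib_left[of "theta_form l" "u + theta_form v * w"] by simp
  moreover have "super_const (pair a l) * u - theta_form m * w \<in> flat_algebra slice"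
    using m(1) * by (intro flat_algebra_diff flat_algebra_const_mult flat_algebra.theta)
  ultimately show ?case using * m(1) theta(1) by (blast intro: flat_algebra.theta)
qed

lemma dir_deriv_section: "f \<in> flat_algebra slice \<Longrightarrow> dir_deriv a f = 0"
  by (rule dir_deriv_vanish) (auto simp: slice_def)

lemma contract_section: "f \<in> flat_algebra slice \<Longrightarrow> contract a f = 0"
  by (rule contract_vanish) (auto simp: slice_def)

lemma contract_section_theta: "f \<in> flat_algebra slice \<Longrightarrow> contract a (theta_form v * f) = f"
  by (simp add: contract_theta v contract_section)

text \<open>Of the three terms of \<open>flat_algebra_split\<close> the derivation kills the first
  two, so the quotient \<open>g\<close> satisfies
  \<open>g + lambda_form v * dir_deriv a g = 0\<close>, which forces \<open>g = 0\<close>.\<close>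

lemma dir_deriv_kernel:
  assumes "f \<in> flat_algebra W" "dir_deriv a f = 0"
  obtains u w where "u \<in> flat_algebra slice" "w \<in> flat_algebra slice" "f = u + theta_form v * w"
proof -
  obtain u w g where *: "u \<in> flat_algebra slice" "w \<in> flat_algebra slice" "g \<in> flat_algebra W"
    "f = u + theta_form v * w + lambda_form v * g" using flat_algebra_split[OF assms(1)] by blast
  have "super_const (of_nat (Suc 0)) * g + lambda_form v * dir_deriv a g = 0"
    using assms(2) *
    by (simp add: linear_op_add[OF linear_op_dir_deriv] dir_deriv_section dir_deriv_theta dir_deriv_lambda v)
  \<comment> \<open>Differentiating the equation for \<open>g\<close> and \<open>r\<close> gives the
    one for \<open>dir_deriv a g\<close> and \<open>r + 1\<close>. So the derivative vanishes by
    induction on the order of nilpotency, and only a nonzero multiple of \<open>g\<close> remains in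
    the equation.\<close>
  moreover have "g = 0" if "(dir_deriv a ^^ N) g = 0"
    "super_const (of_nat (Suc r)) * g + lambda_form v * dir_deriv a g = 0" for N r g
    using that
  proof (induction N arbitrary: g r)
    case (Suc N)
    have "dir_deriv a (super_const (of_nat (Suc r)) * g + lambda_form v * dir_deriv a g) = 0"
      unfolding Suc.prems(2) by (rule linear_op_zero[OF linear_op_dir_deriv])
    then have "super_const (of_nat (Suc (Suc r))) * dir_deriv a g + lambda_form v * dir_deriv a (dir_deriv a g) = 0"
      unfolding linear_op_add[OF linear_op_dir_deriv] linear_op_const[OF linear_op_dir_deriv]
        dir_deriv_lambda v(2) of_nat_Suc[of "Suc r"] super_const_add distrib_right
      by (simp only: add_ac)
    then have "dir_deriv a g = 0"
      using Suc.IH[of "dir_deriv a g"] Suc.prems(1) by (simp only: funpow_Suc_right o_apply)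
    then have "super_const (of_nat (Suc r)) * g = 0" using Suc.prems(2) by simp
    then show ?case by (rule super_const_cancel[rotated]) (rule of_nat_neq_0)
  qed simp
  ultimately have "g = 0" using dir_deriv_nilpotent[OF *(3), of a] by metis
  then show ?thesis using that * by simp
qed

text \<open>On \<open>slice\<close> the normal \<open>a\<close> vanishes and adds nothing to the
  exponents.\<close>

lemma flat_ideal_section:
  assumes "f \<in> flat_ideal A slice" shows "f \<in> flat_ideal (a # A) W"
  by (rule flat_ideal_mono[OF section_subset _ assms]) (simp add: slice_def mult_off_def)

end

section \<open>The dual description of the ideals\<close>

fun flat_dual :: "(complex ^ 'n::{finite,linorder}) list \<Rightarrow> 'n superspace \<Rightarrow> bool" where
  "flat_dual [] f \<longleftrightarrow> ev0 f = 0"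
| "flat_dual (a # A) f \<longleftrightarrow> flat_dual A f \<and> flat_dual A (dir_deriv a f) \<and> flat_dual A (contract a f)"

lemma flat_dual_add: "flat_dual A f \<Longrightarrow> flat_dual A g \<Longrightarrow> flat_dual A (f + g)"
  by (induction A arbitrary: f g)
    (auto simp: linear_op_add[OF linear_op_dir_deriv] linear_op_add[OF linear_op_contract])

lemma flat_dual_const_mult: "flat_dual A f \<Longrightarrow> flat_dual A (super_const c * f)"
  by (induction A arbitrary: f)
    (auto simp: linear_op_const[OF linear_op_dir_deriv] linear_op_const[OF linear_op_contract])

lemma flat_dual_diff: "flat_dual A f \<Longrightarrow> flat_dual A g \<Longrightarrow> flat_dual A (f - g)"
  using flat_dual_add[OF _ flat_dual_const_mult, of A f g "- 1"] by simp

text \<open>Contracting \<open>theta_form l * f\<close> produces a multiple of \<open>f\<close>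
  itself, to which neither operator has been applied; the first clause of \<open>flat_dual\<close>
  covers this term.\<close>

lemma flat_dual_theta: "flat_dual A f \<Longrightarrow> flat_dual A (theta_form l * f)"
  by (induction A arbitrary: f)
    (auto simp: ev0_theta dir_deriv_theta contract_theta intro: flat_dual_diff flat_dual_const_mult)

text \<open>Each clause of \<open>flat_dual\<close> comes from a map of the ideal of
  \<open>a # A\<close> into the ideal of \<open>A\<close>; the chain ends at the empty list, where
  elements of the ideal have no constant term.\<close>

lemma flat_ideal_imp_dual: "f \<in> flat_ideal A W \<Longrightarrow> flat_dual A f"
proof (induction A arbitrary: f)
  case Nil
  then show ?case
    by (induction rule: flat_ideal.induct) (auto simp: mult_off_def ev0_lambda ev0_theta)
next
  case (Cons a A)
  then show ?case
    by (auto intro: flat_ideal_delete flat_ideal_dir_deriv flat_ideal_contract)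
qed

text \<open>Without hyperplanes the generators are the linear forms and thetas of \<open>W\<close>
  themselves, so the ideal is the augmentation ideal.\<close>

lemma flat_ideal_Nil_const:
  "f \<in> flat_algebra W \<Longrightarrow> f - super_const (ev0 f) \<in> flat_ideal [] W"
proof (induction rule: flat_algebra.induct)
  case (add f g)
  show ?case using flat_ideal.add[OF add.IH] by (simp add: super_const_add algebra_simps)
next
  case (lambda l f)
  then show ?case using flat_ideal.lambda[of l W f "[]"] by (simp add: ev0_lambda mult_off_def)
next
  case (theta l f)
  then show ?case using flat_ideal.theta[of l W f "[]"] by (simp add: ev0_theta mult_off_def)
qed (simp add: flat_ideal.zero)

text \<open>\<open>flat_dual A f\<close> says that \<open>ev0 (\<Prod>\<^sub>S dir_deriv a \<Prod>\<^sub>T contract a f) = 0\<close> for all disjoint subfamilies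
  \<open>S\<close> and \<open>T\<close> of \<open>A\<close>; it does not refer to \<open>W\<close>, which is what lets membership descend to subspaces.\<close>

theorem flat_ideal_iff_dual:
  assumes "vec.subspace W" "f \<in> flat_algebra W"
  shows "f \<in> flat_ideal A W \<longleftrightarrow> flat_dual A f"
proof
  show "flat_dual A f \<Longrightarrow> f \<in> flat_ideal A W"
    using assms
  proof (induction A arbitrary: W f)
    case Nil
    show ?case using flat_ideal_Nil_const[OF Nil(3)] Nil(1) by simp
  next
    case (Cons a A)
    show ?case
    proof (cases "\<forall>l\<in>W. pair a l = 0")
      case True
      \<comment> \<open>Here \<open>a\<close> changes no exponent on \<open>W\<close>, so the first
        clause of \<open>flat_dual\<close> is enough.\<close>
      have "f \<in> flat_ideal A W" using Cons.prems by (intro Cons.IH) auto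
      then show ?thesis
        by (rule flat_ideal_mono[OF subset_refl, rotated]) (simp add: mult_off_def True)
    next
      case False
      then obtain l where l: "l \<in> W" "pair a l \<noteq> 0" by auto
      define v where "v = inverse (pair a l) *s l"
      interpret hyperplane_section W a v
        using l Cons.prems(2) by unfold_locales (auto simp: v_def pair_right_simps vec.subspace_scale)
      \<comment> \<open>Subtracting a preimage \<open>F\<close> of the derivative that lies in the
        ideal reduces the claim to an element of the kernel of \<open>dir_deriv a\<close>.\<close>
      have "dir_deriv a f \<in> flat_ideal A W"
        using Cons.prems by (intro Cons.IH dir_deriv_closed) auto
      then obtain F where F: "F \<in> flat_ideal (a # A) W" "dir_deriv a F = dir_deriv a f"
        using dir_deriv_flat_ideal_surj[OF l] by metis
      have Q: "flat_dual (a # A) (f - F)"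
        using Cons.prems(1) flat_ideal_imp_dual[OF F(1)] by (rule flat_dual_diff)
      have "dir_deriv a (f - F) = 0" by (simp add: linear_op_diff[OF linear_op_dir_deriv] F(2))
      moreover have "f - F \<in> flat_algebra W"
        using Cons.prems(3) flat_ideal_subset[OF F(1)] by (rule flat_algebra_diff)
      ultimately obtain u w where uw: "u \<in> flat_algebra slice" "w \<in> flat_algebra slice"
        "f - F = u + theta_form v * w" using dir_deriv_kernel by blast
      \<comment> \<open>The contraction clause isolates \<open>w\<close>, the first clause then
        yields \<open>u\<close>, and the induction hypothesis is applied to both in
        \<open>slice\<close>.\<close>
      have "contract a (f - F) = w"
        using uw by (simp add: linear_op_add[OF linear_op_contract] contract_section contract_section_theta)
      then have w: "flat_dual A w" using Q by simp
      have "u = (f - F) - theta_form v * w" using uw(3) by simp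
      then have "flat_dual A u" using Q w by (auto intro: flat_dual_diff flat_dual_theta)
      then have "u \<in> flat_ideal (a # A) W" "w \<in> flat_ideal (a # A) W"
        using w uw subspace_section by (auto intro!: flat_ideal_section Cons.IH)
      then have "f - F \<in> flat_ideal (a # A) W"
        unfolding uw(3) by (intro flat_ideal.add flat_ideal_theta_mult v)
      then show ?thesis using flat_ideal.add[OF _ F(1)] by force
    qed
  qed
qed (rule flat_ideal_imp_dual)

subsection \<open>A bihomogeneous basis of the quotient\<close>

definition monom_degree :: "('n::finite \<Rightarrow>\<^sub>0 nat) \<Rightarrow> nat" where
  "monom_degree m = (\<Sum>k\<in>UNIV. Poly_Mapping.lookup m k)"

lemma monom_degree_add_single: "monom_degree (m + Poly_Mapping.single k 1) = Suc (monom_degree m)"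
proof -
  have "monom_degree (m + Poly_Mapping.single k 1) = (\<Sum>j\<in>UNIV. Poly_Mapping.lookup m j + (if j = k then 1 else 0))"
    unfolding monom_degree_def by (rule sum.cong) (auto simp: lookup_add lookup_single when_def)
  then show ?thesis by (simp add: sum.distrib monom_degree_def)
qed

definition super_comp :: "nat \<Rightarrow> nat \<Rightarrow> 'n::finite superspace \<Rightarrow> 'n superspace" where
  "super_comp i j f = Superspace (\<lambda>S. if card S = j then
     (\<Sum>m\<in>{m\<in>Poly_Mapping.keys (super_coeff f S). monom_degree m = i}.
       Poly_Mapping.single m (Poly_Mapping.lookup (super_coeff f S) m)) else 0)"

lemma lookup_super_comp:
  "Poly_Mapping.lookup (super_coeff (super_comp i j f) S) m =
    (if card S = j \<and> monom_degree m = i then Poly_Mapping.lookup (super_coeff f S) m else 0)"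
  by (auto simp: super_comp_def lookup_sum lookup_single when_def in_keys_iff)

lemma superspace_lookup_eqI:
  "(\<And>S m. Poly_Mapping.lookup (super_coeff f S) m = Poly_Mapping.lookup (super_coeff g S) m) \<Longrightarrow> f = g"
  by (intro superspace_eqI poly_mapping_eqI)

text \<open>As a fixed point equation of a linear projection, homogeneity can be checked by
  rewriting.\<close>

lemma super_part_iff: "f \<in> super_part i j \<longleftrightarrow> super_comp i j f = f"
proof
  assume "f \<in> super_part i j"
  then have "card S = j \<and> monom_degree m = i" if "Poly_Mapping.lookup (super_coeff f S) m \<noteq> 0" for S m
    using that unfolding in_keys_iff[symmetric] by (simp add: super_part_def monom_degree_def)
  then show "super_comp i j f = f"
    by (intro superspace_lookup_eqI) (auto simp: lookup_super_comp)
next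
  assume *: "super_comp i j f = f"
  show "f \<in> super_part i j"
    unfolding super_part_def
  proof (intro CollectI allI ballI)
    fix S m assume "m \<in> Poly_Mapping.keys (super_coeff f S)"
    then have "Poly_Mapping.lookup (super_coeff (super_comp i j f) S) m \<noteq> 0"
      by (simp add: * in_keys_iff)
    then show "(\<Sum>k\<in>UNIV. Poly_Mapping.lookup m k) = i \<and> card S = j"
      by (auto simp: lookup_super_comp monom_degree_def split: if_splits)
  qed
qed

lemma super_comp_comp:
  "super_comp i j (super_comp i' j' f) = (if i = i' \<and> j = j' then super_comp i j f else 0)"
  by (intro superspace_lookup_eqI) (auto simp: lookup_super_comp)

lemma super_comp_in_part: "super_comp i j (f :: 'n::{finite,linorder} superspace) \<in> super_part i j"
  by (simp add: super_part_iff super_comp_comp)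

lemma super_comp_part: "f \<in> super_part i' j' \<Longrightarrow> super_comp i j f = (if i = i' \<and> j = j' then f else 0)"
  by (metis super_comp_comp super_part_iff)

lemma linear_op_comp: "linear_op (super_comp i j)"
  unfolding linear_op_def
  by (auto intro!: superspace_lookup_eqI simp: lookup_super_comp lookup_add)

lemma super_comp_x: "super_comp i j (super_x k * f) = (case i of 0 \<Rightarrow> 0 | Suc i \<Rightarrow> super_x k * super_comp i j f)"
proof (rule superspace_lookup_eqI)
  fix S m
  show "Poly_Mapping.lookup (super_coeff (super_comp i j (super_x k * f)) S) m =
    Poly_Mapping.lookup (super_coeff (case i of 0 \<Rightarrow> 0 | Suc i \<Rightarrow> super_x k * super_comp i j f) S) m"
  proof (cases "Poly_Mapping.lookup m k = 0")
    case True
    then show ?thesis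
      by (auto simp: lookup_super_comp super_x_def lookup_x_mult[unfolded One_nat_def] split: nat.split)
  next
    case False
    define r where "r = m - Poly_Mapping.single k 1"
    have m: "m = r + Poly_Mapping.single k 1"
      unfolding r_def using False
      by (intro poly_mapping_eqI) (auto simp: lookup_add lookup_minus lookup_single when_def)
    have "monom_degree m = Suc (monom_degree r)" unfolding m by (rule monom_degree_add_single)
    then show ?thesis using False
      by (auto simp: lookup_super_comp super_x_def lookup_x_mult r_def[symmetric] simp del: One_nat_def split: nat.split)
  qed
qed

lemma super_comp_theta: "super_comp i j (super_theta k * f) = (case j of 0 \<Rightarrow> 0 | Suc j \<Rightarrow> super_theta k * super_comp i j f)"
proof (rule superspace_lookup_eqI)
  fix S m
  have "Poly_Mapping.lookup (theta_sign k S * p) m = (if even (card {t \<in> S. t < k}) then 1 else - 1) * Poly_Mapping.lookup p m" for p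
    by (simp add: theta_sign_def)
  moreover have "k \<in> S \<Longrightarrow> card S = Suc (card (S - {k}))"
    by (rule card.remove) auto
  ultimately show "Poly_Mapping.lookup (super_coeff (super_comp i j (super_theta k * f)) S) m =
    Poly_Mapping.lookup (super_coeff (case j of 0 \<Rightarrow> 0 | Suc j \<Rightarrow> super_theta k * super_comp i j f) S) m"
    by (auto simp: lookup_super_comp super_coeff_theta_mult split: nat.split)
qed

lemma super_comp_lambda: "super_comp i j (lambda_form l * f) = (case i of 0 \<Rightarrow> 0 | Suc i \<Rightarrow> lambda_form l * super_comp i j f)"
  unfolding lambda_mult_expand linear_op_sum[OF linear_op_comp] linear_op_const[OF linear_op_comp] super_comp_x
  by (auto split: nat.split)

lemma super_comp_theta_form: "super_comp i j (theta_form l * f) = (case j of 0 \<Rightarrow> 0 | Suc j \<Rightarrow> theta_form l * super_comp i j f)"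
  unfolding theta_mult_expand linear_op_sum[OF linear_op_comp] linear_op_const[OF linear_op_comp] super_comp_theta
  by (auto split: nat.split)

lemma super_comp_lambda_power:
  "super_comp i j (lambda_form l ^ r * f) = (if i < r then 0 else lambda_form l ^ r * super_comp (i - r) j f)"
proof (induction r arbitrary: i)
  case (Suc r)
  then show ?case by (auto simp: mult.assoc super_comp_lambda split: nat.split)
qed simp

lemma super_comp_const: "super_comp i j (super_const c) = (if i = 0 \<and> j = 0 then super_const c else 0)"
  by (rule superspace_lookup_eqI)
    (auto simp: lookup_super_comp super_const_def super_poly_def lookup_single when_def monom_degree_def
      intro!: poly_mapping_eqI)

lemma dir_deriv_comp: "dir_deriv a (super_comp (Suc i) j f) = super_comp i j (dir_deriv a f)"
proof -
  have "super_pderiv k (super_comp (Suc i) j f) = super_comp i j (super_pderiv k f)" for k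
    using monom_degree_add_single[of _ k]
    by (intro superspace_lookup_eqI) (auto simp: super_pderiv_def lookup_mpoly_pderiv lookup_super_comp)
  then show ?thesis
    by (simp add: dir_deriv_def linear_op_sum[OF linear_op_comp] linear_op_const[OF linear_op_comp])
qed

lemma flat_algebra_comp: "f \<in> flat_algebra W \<Longrightarrow> super_comp i j f \<in> flat_algebra W"
  by (induction arbitrary: i j rule: flat_algebra.induct)
    (auto simp: super_comp_const linear_op_add[OF linear_op_comp] super_comp_lambda super_comp_theta_form
      split: nat.split intro: flat_algebra.intros)

text \<open>The generators are bihomogeneous, so taking a component only replaces the cofactor by
  one of its components, or gives 0.\<close>

lemma flat_ideal_comp: "f \<in> flat_ideal A W \<Longrightarrow> super_comp i j f \<in> flat_ideal A W"
proof (induction arbitrary: i j rule: flat_ideal.induct)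
  case zero
  then show ?case by (simp add: linear_op_zero[OF linear_op_comp] flat_ideal.zero)
next
  case (add f g)
  then show ?case by (simp add: linear_op_add[OF linear_op_comp] flat_ideal.add)
next
  case (lambda l g)
  then show ?case unfolding super_comp_lambda_power
    by (auto simp del: power_Suc intro: flat_ideal.zero flat_ideal.lambda flat_algebra_comp)
next
  case (theta l g)
  then show ?case unfolding super_comp_lambda_power super_comp_theta_form
    by (auto split: nat.split intro: flat_ideal.zero flat_ideal.theta flat_algebra_comp)
qed

section \<open>Bihomogeneous bases and the deletion-contraction step\<close>

type_synonym 'n graded_list = "((nat \<times> nat) \<times> 'n superspace) list"

definition lin :: "complex list \<Rightarrow> 'n::{finite,linorder} graded_list \<Rightarrow> 'n superspace" where
  "lin cs bs = sum_list (map2 (\<lambda>c b. super_const c * snd b) cs bs)"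

lemma lin_simps [simp]:
  "lin [] bs = 0" "lin cs [] = 0" "lin (c # cs) (b # bs) = super_const c * snd b + lin cs bs"
  by (simp_all add: lin_def)

lemma lin_append:
  "length cs = length bs \<Longrightarrow> lin (cs @ cs') (bs @ bs') = lin cs bs + lin cs' bs'"
  by (simp add: lin_def)

lemma lin_map:
  assumes "linear_op F" "\<And>b. b \<in> set bs \<Longrightarrow> F (snd (h b)) = snd (h' b)"
  shows "F (lin cs (map h bs)) = lin cs (map h' bs)"
  using assms(2)
proof (induction bs arbitrary: cs)
  case (Cons b bs)
  then show ?case
    by (cases cs) (auto simp: linear_op_zero[OF assms(1)] linear_op_add[OF assms(1)] linear_op_const[OF assms(1)])
qed (simp add: linear_op_zero[OF assms(1)])

lemma lin_in_flat_algebra: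
  "(\<And>b. b \<in> set bs \<Longrightarrow> snd b \<in> flat_algebra W) \<Longrightarrow> lin cs bs \<in> flat_algebra W"
proof (induction bs arbitrary: cs)
  case (Cons b bs)
  have "snd b \<in> flat_algebra W" "\<And>cs. lin cs bs \<in> flat_algebra W" using Cons by simp_all
  then show ?case by (cases cs) (auto intro: flat_algebra.add flat_algebra_const_mult)
qed simp

text \<open>The labels are bidegrees, and the listed elements represent a complex basis of
  \<open>flat_algebra W\<close> modulo \<open>flat_ideal A W\<close>. Coefficient lists avoid
  forming this quotient for every \<open>W\<close>.\<close>

definition flat_basis ::
    "(complex ^ 'n::{finite,linorder}) list \<Rightarrow> (complex ^ 'n::{finite,linorder}) set \<Rightarrow> 'n graded_list \<Rightarrow> bool" where
  "flat_basis A W bs \<longleftrightarrow>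
     (\<forall>b\<in>set bs. snd b \<in> flat_algebra W \<and> snd b \<in> super_part (fst (fst b)) (snd (fst b))) \<and>
     (\<forall>f\<in>flat_algebra W. \<exists>cs. length cs = length bs \<and> f - lin cs bs \<in> flat_ideal A W) \<and>
     (\<forall>cs. length cs = length bs \<and> lin cs bs \<in> flat_ideal A W \<longrightarrow> set cs \<subseteq> {0})"

lemma flat_basis_graded: "flat_basis A W bs \<Longrightarrow> b \<in> set bs \<Longrightarrow> snd b \<in> flat_algebra W"
    "flat_basis A W bs \<Longrightarrow> b \<in> set bs \<Longrightarrow> snd b \<in> super_part (fst (fst b)) (snd (fst b))"
  and flat_basis_span: "flat_basis A W bs \<Longrightarrow> f \<in> flat_algebra W \<Longrightarrow>
    \<exists>cs. length cs = length bs \<and> f - lin cs bs \<in> flat_ideal A W"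
  and flat_basis_indep: "flat_basis A W bs \<Longrightarrow> length cs = length bs \<Longrightarrow>
    lin cs bs \<in> flat_ideal A W \<Longrightarrow> set cs \<subseteq> {0}"
  by (auto simp: flat_basis_def)

lemma lin_zero_coeffs: "set cs \<subseteq> {0} \<Longrightarrow> lin cs bs = 0"
proof (induction cs arbitrary: bs)
  case (Cons c cs)
  then show ?case by (cases bs) auto
qed simp

text \<open>The recursion shared by both sides; \<open>j\<close> is a fermionic degree on one and a
  codimension on the other. The case distinction on \<open>j\<close> is the summand \<open>t\<close>
  in the factor \<open>1 + t\<close>.\<close>

fun flat_count :: "(complex ^ 'n) list \<Rightarrow> (complex ^ 'n) set \<Rightarrow> nat \<Rightarrow> nat" where
  "flat_count [] W j = (if j = 0 then 1 else 0)"
| "flat_count (a # A) W j = flat_count A W j +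
     (if \<forall>l\<in>W. pair a l = 0 then 0
      else flat_count A (W \<inter> {l. pair a l = 0}) j +
        (case j of 0 \<Rightarrow> 0 | Suc i \<Rightarrow> flat_count A (W \<inter> {l. pair a l = 0}) i))"

text \<open>An exact sequence in terms of bases: \<open>dir_deriv a\<close> maps the quotient on
  \<open>W\<close> onto that of the deletion, and its kernel is the quotient on \<open>slice\<close>
  plus \<open>theta_form v\<close> times a second copy. \<open>L\<close> lifts a basis of the right
  end.\<close>

lemma (in hyperplane_section) flat_basis_step:
  assumes b1: "flat_basis A W bs1" and b2: "flat_basis A slice bs2"
    and L: "\<And>b. b \<in> set bs1 \<Longrightarrow> L b \<in> flat_algebra W \<and>
      L b \<in> super_part (Suc (fst (fst b))) (snd (fst b)) \<and> dir_deriv a (L b) = snd b"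
  shows "flat_basis (a # A) W (map (\<lambda>b. ((Suc (fst (fst b)), snd (fst b)), L b)) bs1 @ bs2 @
    map (\<lambda>b. ((fst (fst b), Suc (snd (fst b))), theta_form v * snd b)) bs2)"
    (is "flat_basis _ _ (?bs1 @ bs2 @ ?bs3)")
  unfolding flat_basis_def
proof (intro conjI ballI allI impI)
  fix b assume b: "b \<in> set (?bs1 @ bs2 @ ?bs3)"
  show "snd b \<in> flat_algebra W"
  proof -
    have *: "snd c \<in> flat_algebra W" if "c \<in> set bs2" for c
      using flat_basis_graded(1)[OF b2 that] by (rule flat_algebra_mono[OF section_subset])
    from b have "b \<in> set bs2 \<or> (\<exists>c\<in>set bs1. snd b = L c) \<or> (\<exists>c\<in>set bs2. snd b = theta_form v * snd c)"
      by force
    then show ?thesis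
      by (elim disjE bexE) (simp_all add: L * v flat_algebra.theta)
  qed
  have "theta_form v * f \<in> super_part i (Suc j)" if "f \<in> super_part i j" for f i j
    using that by (simp add: super_part_iff super_comp_theta_form)
  then show "snd b \<in> super_part (fst (fst b)) (snd (fst b))"
    using b L flat_basis_graded(2)[OF b2] by auto
next
  have d1: "dir_deriv a (lin cs ?bs1) = lin cs bs1" for cs
    using lin_map[OF linear_op_dir_deriv, of bs1 a "\<lambda>b. ((Suc (fst (fst b)), snd (fst b)), L b)" id cs] L by simp
  have t: "lin cs ?bs3 = theta_form v * lin cs bs2" for cs
    using lin_map[OF linear_op_mult, of bs2 "theta_form v" id "\<lambda>b. ((fst (fst b), Suc (snd (fst b))), theta_form v * snd b)" cs]
    by simp
  have l2: "lin cs bs2 \<in> flat_algebra slice" for cs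
    using flat_basis_graded(1)[OF b2] by (rule lin_in_flat_algebra)
  have l1: "lin cs ?bs1 \<in> flat_algebra W" for cs
    using L by (intro lin_in_flat_algebra) auto
  {
    fix f assume f: "f \<in> flat_algebra W"
    obtain c1 where c1: "length c1 = length bs1" "dir_deriv a f - lin c1 bs1 \<in> flat_ideal A W"
      using flat_basis_span[OF b1 dir_deriv_closed[OF f]] by blast
    then obtain F where F: "F \<in> flat_ideal (a # A) W" "dir_deriv a F = dir_deriv a f - lin c1 bs1"
      using dir_deriv_flat_ideal_surj[of v W a] v by auto
    have "dir_deriv a (f - lin c1 ?bs1 - F) = 0"
      by (simp add: linear_op_diff[OF linear_op_dir_deriv] d1 F(2))
    moreover have "f - lin c1 ?bs1 - F \<in> flat_algebra W"
      using f l1 flat_ideal_subset[OF F(1)] by (intro flat_algebra_diff)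
    ultimately obtain u w where uw: "u \<in> flat_algebra slice" "w \<in> flat_algebra slice"
      "f - lin c1 ?bs1 - F = u + theta_form v * w" using dir_deriv_kernel by blast
    obtain c2 c3 where c: "length c2 = length bs2" "u - lin c2 bs2 \<in> flat_ideal A slice"
      "length c3 = length bs2" "w - lin c3 bs2 \<in> flat_ideal A slice"
      using flat_basis_span[OF b2] uw by blast
    have "f - lin (c1 @ c2 @ c3) (?bs1 @ bs2 @ ?bs3) =
        F + ((u - lin c2 bs2) + theta_form v * (w - lin c3 bs2))"
      using uw(3) c c1 by (simp add: lin_append t algebra_simps)
    also have "\<dots> \<in> flat_ideal (a # A) W"
      using flat_ideal_section[OF c(2)] flat_ideal_section[OF c(4)] v
      by (intro flat_ideal.add[OF F(1)] flat_ideal.add flat_ideal_theta_mult)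
    finally show "\<exists>cs. length cs = length (?bs1 @ bs2 @ ?bs3) \<and>
        f - lin cs (?bs1 @ bs2 @ ?bs3) \<in> flat_ideal (a # A) W"
      using c c1 by (intro exI[of _ "c1 @ c2 @ c3"]) simp
  next
    fix cs assume cs: "length cs = length (?bs1 @ bs2 @ ?bs3) \<and> lin cs (?bs1 @ bs2 @ ?bs3) \<in> flat_ideal (a # A) W"
    define c1 c2 c3 where "c1 = take (length bs1) cs" and "c2 = take (length bs2) (drop (length bs1) cs)"
      and "c3 = drop (length bs2) (drop (length bs1) cs)"
    have len: "length c1 = length bs1" "length c2 = length bs2" "length c3 = length bs2"
      using cs by (auto simp: c1_def c2_def c3_def)
    have eq: "cs = c1 @ c2 @ c3" unfolding c1_def c2_def c3_def by (simp only: append_take_drop_id)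
    have I: "lin c1 ?bs1 + (lin c2 bs2 + theta_form v * lin c3 bs2) \<in> flat_ideal (a # A) W"
      using cs len unfolding eq by (simp add: lin_append t)
    \<comment> \<open>The derivation kills the last two blocks and turns the lifts back into
      \<open>bs1\<close>.\<close>
    from flat_ideal_dir_deriv[OF this] have "lin c1 bs1 \<in> flat_ideal A W"
      by (simp add: linear_op_add[OF linear_op_dir_deriv] d1 dir_deriv_section[OF l2] dir_deriv_theta)
    then have c1: "set c1 \<subseteq> {0}" using flat_basis_indep[OF b1] len by blast
    then have I: "lin c2 bs2 + theta_form v * lin c3 bs2 \<in> flat_ideal (a # A) W"
      using I by (simp add: lin_zero_coeffs)
    note section_dual = flat_ideal_iff_dual[OF subspace_section l2, of _ A]
    \<comment> \<open>Contraction extracts the third block, but only as an element of the ideal on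
      \<open>W\<close>; the dual description, in which \<open>W\<close> does not occur, moves it to
      the ideal on \<open>slice\<close>.\<close>
    from flat_ideal_contract[OF I] have "lin c3 bs2 \<in> flat_ideal A W"
      by (simp add: linear_op_add[OF linear_op_contract] contract_section contract_section_theta l2)
    then have "lin c3 bs2 \<in> flat_ideal A slice"
      using section_dual flat_ideal_imp_dual by blast
    then have c3: "set c3 \<subseteq> {0}" using flat_basis_indep[OF b2] len by blast
    then have "lin c2 bs2 \<in> flat_ideal A W"
      using flat_ideal_delete[OF I] by (simp add: lin_zero_coeffs)
    then have "lin c2 bs2 \<in> flat_ideal A slice"
      using section_dual flat_ideal_imp_dual by blast
    then have "set c2 \<subseteq> {0}" using flat_basis_indep[OF b2] len by blast
    then show "set cs \<subseteq> {0}" using c1 c3 by (simp add: eq)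
  }
qed

theorem flat_basis_exists:
  assumes "vec.subspace W"
  shows "\<exists>bs. flat_basis A W bs \<and> (\<forall>j. length (filter (\<lambda>b. snd (fst b) = j) bs) = flat_count A W j)"
  using assms
proof (induction A arbitrary: W)
  case Nil
  have "flat_basis [] W [((0, 0), super_const 1)]"
    unfolding flat_basis_def
  proof (intro conjI ballI allI impI)
    fix f assume "f \<in> flat_algebra W"
    then show "\<exists>cs. length cs = length [((0::nat, 0::nat), super_const 1)] \<and>
        f - lin cs [((0, 0), super_const 1)] \<in> flat_ideal [] W"
      using flat_ideal_Nil_const by (intro exI[of _ "[ev0 f]"]) simp
  next
    fix cs assume *: "length cs = length [((0::nat, 0::nat), super_const 1 :: 'a superspace)] \<and>
        lin cs [((0, 0), super_const 1)] \<in> flat_ideal [] W"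
    then obtain c where c: "cs = [c]" by (auto simp: length_Suc_conv)
    have "flat_dual [] (lin cs [((0::nat, 0::nat), super_const 1 :: 'a superspace)])"
      using * by (blast intro: flat_ideal_imp_dual)
    then show "set cs \<subseteq> {0}" by (simp add: c)
  qed (use flat_algebra.const[of 1 W] super_comp_const[of 0 0 1] in \<open>auto simp: super_part_iff\<close>)
  then show ?case by (intro exI[of _ "[((0, 0), super_const 1)]"]) auto
next
  case (Cons a A)
  show ?case
  proof (cases "\<forall>l\<in>W. pair a l = 0")
    case True
    then have "mult_off (a # A) l = mult_off A l" if "l \<in> W" for l
      using that by (simp add: mult_off_def)
    then have "flat_ideal (a # A) W = flat_ideal A W"
      using flat_ideal_mono[of W W "a # A" A] flat_ideal_mono[of W W A "a # A"] by auto
    then have "flat_basis (a # A) W = flat_basis A W" unfolding flat_basis_def by simp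
    then show ?thesis using Cons.IH[OF Cons.prems] True by simp
  next
    case False
    then obtain l where l: "l \<in> W" "pair a l \<noteq> 0" by auto
    define v where "v = inverse (pair a l) *s l"
    interpret hyperplane_section W a v
      using l Cons.prems by unfold_locales (auto simp: v_def pair_right_simps vec.subspace_scale)
    obtain bs1 where bs1: "flat_basis A W bs1"
      "\<And>j. length (filter (\<lambda>b. snd (fst b) = j) bs1) = flat_count A W j"
      using Cons.IH[OF Cons.prems] by auto
    obtain bs2 where bs2: "flat_basis A slice bs2"
      "\<And>j. length (filter (\<lambda>b. snd (fst b) = j) bs2) = flat_count A slice j"
      using Cons.IH[OF subspace_section] by auto
    have "\<exists>F. F \<in> flat_algebra W \<and> F \<in> super_part (Suc (fst (fst b))) (snd (fst b)) \<and> dir_deriv a F = snd b"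
      if b: "b \<in> set bs1" for b
    proof -
      obtain h where h: "h \<in> flat_algebra W" "dir_deriv a (lambda_form v ^ Suc 0 * h) = lambda_form v ^ 0 * snd b"
        using dir_deriv_integrate[OF v(1) _ flat_basis_graded(1)[OF bs1(1) b], of a 0] v by auto
      \<comment> \<open>The integral need not be homogeneous. Its component one bosonic degree above
        \<open>snd b\<close> has the same derivative, since the derivation lowers that degree by one
        and \<open>snd b\<close> is homogeneous.\<close>
      let ?F = "super_comp (Suc (fst (fst b))) (snd (fst b)) (lambda_form v * h)"
      have "dir_deriv a ?F = snd b"
        using h(2) flat_basis_graded(2)[OF bs1(1) b] by (simp add: dir_deriv_comp super_part_iff)
      then show ?thesis
        using super_comp_in_part flat_algebra_comp[OF flat_algebra.lambda[OF v(1) h(1)]] by blast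
    qed
    then obtain L where L: "\<And>b. b \<in> set bs1 \<Longrightarrow> L b \<in> flat_algebra W \<and>
        L b \<in> super_part (Suc (fst (fst b))) (snd (fst b)) \<and> dir_deriv a (L b) = snd b"
      by metis
    show ?thesis
    proof (rule exI, rule conjI, rule flat_basis_step[OF bs1(1) bs2(1) L], assumption, rule allI)
      fix j
      have "length (filter (\<lambda>b. Suc (snd (fst b)) = j) bs2) =
          (case j of 0 \<Rightarrow> 0 | Suc i \<Rightarrow> flat_count A slice i)"
        using bs2(2) by (cases j) auto
      then show "length (filter (\<lambda>b. snd (fst b) = j) (map (\<lambda>b. ((Suc (fst (fst b)), snd (fst b)), L b)) bs1 @ bs2 @
          map (\<lambda>b. ((fst (fst b), Suc (snd (fst b))), theta_form v * snd b)) bs2)) = flat_count (a # A) W j"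
        using bs1(2)[of j] bs2(2)[of j] if_not_P[OF False]
        by (simp only: flat_count.simps slice_def[symmetric] if_not_P[OF False])
          (simp add: filter_map o_def)
    qed
  qed
qed

subsection \<open>The quotient ring\<close>

lemma ring_of_type_algebra_simps [simp]:
  "carrier ring_of_type_algebra = UNIV"
  "x \<otimes>\<^bsub>ring_of_type_algebra\<^esub> y = x * y"
  "x \<oplus>\<^bsub>ring_of_type_algebra\<^esub> y = x + y"
  "\<one>\<^bsub>ring_of_type_algebra\<^esub> = 1"
  "\<zero>\<^bsub>ring_of_type_algebra\<^esub> = 0"
  by (simp_all add: ring_of_type_algebra_def)

lemma uminus_ring_of_type_algebra [simp]:
  "\<ominus>\<^bsub>ring_of_type_algebra\<^esub> x = - (x :: 'n::{finite,linorder} superspace)"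
proof -
  interpret R: ring "ring_of_type_algebra :: 'n superspace ring" by (rule ring_superspace)
  show ?thesis using R.minus_equality[of "- x" x] by simp
qed

lemma flat_ideal_mult_right: "f \<in> flat_ideal A UNIV \<Longrightarrow> f * x \<in> flat_ideal A UNIV"
proof (induction rule: flat_ideal.induct)
  case (lambda l g)
  show ?case unfolding mult.assoc[of _ g x] by (rule flat_ideal.lambda) auto
next
  case (theta l g)
  show ?case unfolding mult.assoc[of "theta_form l"] mult.assoc[of _ g x] by (rule flat_ideal.theta) auto
qed (auto simp: distrib_right intro: flat_ideal.zero flat_ideal.add)

lemma flat_ideal_mult_left:
  assumes "f \<in> flat_ideal A UNIV" shows "x * f \<in> flat_ideal A UNIV"
  using flat_algebra_UNIV[of x]
  by (induction rule: flat_algebra.induct)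
    (auto simp: assms distrib_right mult.assoc flat_ideal_const_mult flat_ideal.add
      flat_ideal_lambda_mult flat_ideal_theta_mult)

lemma ideal_flat_ideal: "ideal (flat_ideal A UNIV) ring_of_type_algebra"
proof (rule idealI[OF ring_superspace])
  interpret R: ring "ring_of_type_algebra :: 'a superspace ring" by (rule ring_superspace)
  show "subgroup (flat_ideal A UNIV) (add_monoid ring_of_type_algebra)"
    by (rule R.add.subgroupI)
      (auto simp: a_inv_def[symmetric] flat_ideal.add flat_ideal_uminus intro: flat_ideal.zero)
qed (auto simp: flat_ideal_mult_left flat_ideal_mult_right)

text \<open>The generators differ only by the nonzero numerical factor in
  \<open>euler_lambda_power\<close> and by the vector 0, whose generators are 0; a line lies in a
  hyperplane iff its spanning vector does.\<close>

lemma arr_ideal_eq_flat_ideal: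
  fixes A :: "(complex ^ 'n::{finite,linorder}) set list"
  assumes "length N = length A" "\<And>i. i < length A \<Longrightarrow> A ! i = {z. pair (N ! i) z = 0}"
  shows "arr_ideal A = flat_ideal N UNIV"
proof -
  interpret R: ring "ring_of_type_algebra :: 'n superspace ring" by (rule ring_superspace)
  have line: "line_through l \<subseteq> {z. pair a z = 0} \<longleftrightarrow> pair a l = 0" for a l :: "complex ^ 'n::{finite,linorder}"
  proof -
    have "l \<in> line_through l" unfolding line_through_def by (rule range_eqI[of _ _ 1]) simp
    then show ?thesis by (auto simp: line_through_def pair_right_simps)
  qed
  have rho: "rho A (line_through l) = mult_off N l" for l
  proof -
    have "\<not> line_through l \<subseteq> A ! i \<longleftrightarrow> pair (N ! i) l \<noteq> 0" if "i < length A" for i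
      unfolding assms(2)[OF that] line ..
    then show ?thesis
      unfolding rho_def mult_off_def length_filter_conv_card assms(1)
      by (intro arg_cong[where f = card] Collect_cong) auto
  qed
  let ?S = "\<Union>l\<in>- {0}. let g = lambda_form l ^ (rho A (line_through l) + 1) in {g, euler g}"
  have gen: "lambda_form l ^ Suc (mult_off N l) \<in> flat_ideal N UNIV"
    "theta_form l * lambda_form l ^ mult_off N l \<in> flat_ideal N UNIV" for l
    using flat_ideal.lambda[of l UNIV 1 N] flat_ideal.theta[of l UNIV 1 N] by auto
  have "?S \<subseteq> flat_ideal N UNIV"
    using gen by (auto simp: Let_def rho euler_lambda_power flat_ideal_const_mult simp del: power_Suc)
  moreover have "flat_ideal N UNIV \<subseteq> J" if J: "ideal J ring_of_type_algebra" "?S \<subseteq> J" for J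
  proof
    interpret J: ideal J ring_of_type_algebra by (rule J(1))
    have r: "f \<in> J \<Longrightarrow> f * x \<in> J" and l: "f \<in> J \<Longrightarrow> x * f \<in> J" for f x
      using J.I_r_closed[of f x] J.I_l_closed[of f x] by auto
    have lam: "lambda_form l ^ Suc (mult_off N l) \<in> J" for l
    proof (cases "l = 0")
      case True
      then show ?thesis using J.zero_closed by (simp add: form_simps)
    next
      case False
      then show ?thesis using J(2) by (auto simp: Let_def rho)
    qed
    have the: "theta_form l * lambda_form l ^ mult_off N l \<in> J" for l
    proof (cases "l = 0")
      case True
      then show ?thesis using J.zero_closed by (simp add: form_simps)
    next
      case False
      then have "super_const (of_nat (Suc (mult_off N l))) * (theta_form l * lambda_form l ^ mult_off N l) \<in> J"
        using J(2) unfolding euler_lambda_power[symmetric] by (auto simp: Let_def rho)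
      from l[OF this, of "super_const (inverse (of_nat (Suc (mult_off N l))))"] show ?thesis
        by (simp only: super_const_inverse(2)[OF of_nat_neq_0])
    qed
    fix f assume "f \<in> flat_ideal N UNIV"
    then show "f \<in> J"
    proof (induction rule: flat_ideal.induct)
      case zero
      show ?case using J.zero_closed by simp
    next
      case (add f g)
      then show ?case using J.a_closed[of f g] by simp
    next
      case (lambda l g)
      show ?case by (rule r[OF lam])
    next
      case (theta l g)
      show ?case using r[OF the, of l g] by (simp add: mult.assoc)
    qed
  qed
  ultimately show ?thesis
    unfolding arr_ideal_def
    using R.genideal_minimal[OF ideal_flat_ideal] R.genideal_ideal[of ?S] R.genideal_self[of ?S]
    by (intro equalityI) auto
qed

lemma subfield_consts: "subfield (range super_const) (ring_of_type_algebra :: 'n::{finite,linorder} superspace ring)"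
proof -
  interpret R: ring "ring_of_type_algebra :: 'n superspace ring" by (rule ring_superspace)
  show ?thesis
  proof (rule R.subfieldI[OF R.subcringI[OF R.subringI]])
    show "\<one>\<^bsub>ring_of_type_algebra\<^esub> \<in> range (super_const :: complex \<Rightarrow> 'n superspace)"
      by (rule range_eqI[of _ _ 1]) simp
    show "\<ominus>\<^bsub>ring_of_type_algebra\<^esub> h \<in> range super_const" if "h \<in> range super_const" for h :: "'n superspace"
      using that by (auto simp: image_iff super_const_mult[of "- 1", simplified] intro: exI[of _ "- x" for x])
    let ?U = "ring_of_type_algebra \<lparr> carrier := range (super_const :: complex \<Rightarrow> 'n superspace) \<rparr>"
    show "Units ?U = range super_const - {\<zero>\<^bsub>ring_of_type_algebra\<^esub>}"
    proof (intro equalityI subsetI)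
      fix x assume x: "x \<in> range super_const - {\<zero>\<^bsub>ring_of_type_algebra :: 'n superspace ring\<^esub>}"
      then obtain c where "x = super_const c" by blast
      moreover from this have "c \<noteq> 0" using x by auto
      ultimately show "x \<in> Units ?U"
        by (auto simp: Units_def super_const_mult[symmetric] intro!: exI[of _ "inverse c"])
    qed (auto simp: Units_def)
  qed (auto simp: super_const_add[symmetric] super_const_mult[symmetric] mult.commute)
qed

lemma flat_dual_ev0: "flat_dual A f \<Longrightarrow> ev0 f = 0"
  by (induction A) auto

lemma lin_in_super_part:
  "(\<And>b. b \<in> set bs \<Longrightarrow> snd b \<in> super_part i j) \<Longrightarrow> lin cs bs \<in> super_part i j"
  using lin_map[OF linear_op_comp, of bs i j id id cs] by (simp add: super_part_iff)

text \<open>Coefficients off the filter are padded with 0. The inclusion of coefficient sets passes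
  the vanishing of \<open>ds\<close> back to \<open>cs\<close>.\<close>

lemma lin_filter_extend:
  "length cs = length (filter P bs) \<Longrightarrow>
    \<exists>ds. length ds = length bs \<and> lin ds bs = lin cs (filter P bs) \<and> set cs \<subseteq> set ds"
proof (induction bs arbitrary: cs)
  case (Cons b bs)
  show ?case
  proof (cases "P b")
    case True
    then obtain c cs' where cs: "cs = c # cs'" "length cs' = length (filter P bs)"
      using Cons.prems by (auto simp: length_Suc_conv)
    then obtain ds where "length ds = length bs" "lin ds bs = lin cs' (filter P bs)" "set cs' \<subseteq> set ds"
      using Cons.IH by blast
    then show ?thesis using True cs by (intro exI[of _ "c # ds"]) auto
  next
    case False
    then obtain ds where "length ds = length bs" "lin ds bs = lin cs (filter P bs)" "set cs \<subseteq> set ds"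
      using Cons.IH[of cs] Cons.prems by auto
    then show ?thesis using False by (intro exI[of _ "0 # ds"]) auto
  qed
qed simp

lemma super_comp_lin:
  assumes "\<And>b. b \<in> set bs \<Longrightarrow> snd b \<in> super_part (fst (fst b)) (snd (fst b))" "length cs = length bs"
  shows "\<exists>ds. length ds = length (filter (\<lambda>b. fst b = (i, j)) bs) \<and>
    super_comp i j (lin cs bs) = lin ds (filter (\<lambda>b. fst b = (i, j)) bs)"
  using assms
proof (induction bs arbitrary: cs)
  case Nil
  then show ?case by (simp add: linear_op_zero[OF linear_op_comp])
next
  case (Cons b bs)
  then obtain c cs' where cs: "cs = c # cs'" "length cs' = length bs"
    by (auto simp: length_Suc_conv)
  have "\<exists>ds. length ds = length (filter (\<lambda>b. fst b = (i, j)) bs) \<and>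
      super_comp i j (lin cs' bs) = lin ds (filter (\<lambda>b. fst b = (i, j)) bs)"
    using Cons.prems(1) cs(2) by (intro Cons.IH) simp_all
  then obtain ds where ds: "length ds = length (filter (\<lambda>b. fst b = (i, j)) bs)"
      "super_comp i j (lin cs' bs) = lin ds (filter (\<lambda>b. fst b = (i, j)) bs)"
    by blast
  have "snd b \<in> super_part (fst (fst b)) (snd (fst b))" using Cons.prems(1) by simp
  then have b: "super_comp i j (snd b) = (if fst b = (i, j) then snd b else 0)"
    by (subst super_comp_part) (auto simp: prod_eq_iff)
  show ?case
    using ds b unfolding cs(1)
    by (cases "fst b = (i, j)")
      (auto simp: linear_op_add[OF linear_op_comp] linear_op_const[OF linear_op_comp] intro: exI[of _ "c # ds"])
qed

lemma combine_eq_lin: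
  "ring.combine ring_of_type_algebra (map super_const cs) (map snd bs) = lin cs (bs :: 'n::{finite,linorder} graded_list)"
proof -
  interpret R: ring "ring_of_type_algebra :: 'n superspace ring" by (rule ring_superspace)
  show ?thesis
  proof (induction bs arbitrary: cs)
    case (Cons b bs)
    then show ?case by (cases cs) auto
  qed simp
qed

text \<open>The ideal is bihomogeneous, so the basis elements labelled \<open>(i, j)\<close>
  represent a basis of that component.\<close>

theorem arr_quotient_dim_eq:
  fixes A :: "(complex ^ 'n::{finite,linorder}) set list"
  assumes I: "arr_ideal A = flat_ideal N UNIV" and bs: "flat_basis N UNIV bs"
  shows "arr_quotient_dim A i j = length (filter (\<lambda>b. fst b = (i, j)) bs)"
proof -
  let ?R = "ring_of_type_algebra :: 'n superspace ring"
  let ?p = "arr_proj A"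
  interpret I: ideal "arr_ideal A" ?R unfolding I by (rule ideal_flat_ideal)
  interpret H: ring_hom_ring ?R "arr_quotient A" ?p
    using I.rcos_ring_hom_ring unfolding arr_quotient_def arr_proj_def[abs_def] .
  have zero: "\<zero>\<^bsub>arr_quotient A\<^esub> = arr_ideal A"
    by (simp add: arr_quotient_def FactRing_def)
  have ker: "?p f = \<zero>\<^bsub>arr_quotient A\<^esub> \<longleftrightarrow> f \<in> flat_ideal N UNIV" for f
    unfolding zero I[symmetric] arr_proj_def
    using I.a_rcos_const[of f] I.a_rcos_self[of f] by auto
  have cong: "?p f = ?p g" if "f - g \<in> flat_ideal N UNIV" for f g
    using H.hom_add[of "f - g" g] that ker[of "f - g"] by simp
  \<comment> \<open>The constant term separates 1 from the ideal, so the constants still form a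
    field in the quotient.\<close>
  have one: "\<one>\<^bsub>arr_quotient A\<^esub> \<noteq> \<zero>\<^bsub>arr_quotient A\<^esub>"
  proof -
    have "ev0 (1 :: 'n superspace) = 1" by (simp add: ev0_def one_superspace_def)
    then have "1 \<notin> flat_ideal N UNIV" using flat_dual_ev0[OF flat_ideal_imp_dual, of 1 N UNIV] by auto
    then show ?thesis using ker[of 1] H.hom_one by simp
  qed
  let ?K = "?p ` range super_const"
  have K: "subfield ?K (arr_quotient A)"
    by (rule H.img_is_subfield(2)[OF subfield_consts one])
  define cs where "cs = filter (\<lambda>b. fst b = (i, j)) bs"
  have cs_part: "snd b \<in> super_part i j" if "b \<in> set cs" for b
    using that flat_basis_graded(2)[OF bs, of b] by (auto simp: cs_def)
  let ?U = "map ?p (map snd cs)"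
  have U: "set ?U \<subseteq> carrier (arr_quotient A)"
    using H.hom_closed by auto
  have comb: "H.S.combine (map ?p (map super_const ks)) ?U = ?p (lin ks cs)" for ks
    by (subst H.combine_hom) (auto simp: combine_eq_lin)
  have ex_const: "\<exists>ks. Ks = map ?p (map super_const ks)" if "set Ks \<subseteq> ?K" for Ks
    using that
  proof (induction Ks)
    case (Cons k Ks)
    then obtain c ks where "k = ?p (super_const c)" "Ks = map ?p (map super_const ks)" by auto
    then show ?case by (intro exI[of _ "c # ks"]) simp
  qed simp
  have "H.S.independent ?K ?U"
  proof (rule ccontr)
    assume "\<not> H.S.independent ?K ?U"
    then obtain Ks where Ks: "length Ks = length ?U" "H.S.combine Ks ?U = \<zero>\<^bsub>arr_quotient A\<^esub>"
      "set Ks \<subseteq> ?K" "set Ks \<noteq> {\<zero>\<^bsub>arr_quotient A\<^esub>}"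
      using H.S.dependent_imp_non_trivial_combine[OF K U] by blast
    obtain ks where ks: "Ks = map ?p (map super_const ks)" using ex_const[OF Ks(3)] by blast
    then have "lin ks cs \<in> flat_ideal N UNIV" using Ks(2) comb ker by simp
    moreover obtain ds where ds: "length ds = length bs" "lin ds bs = lin ks cs" "set ks \<subseteq> set ds"
      using lin_filter_extend[of ks "\<lambda>b. fst b = (i, j)" bs] Ks(1) unfolding ks cs_def by auto
    ultimately have "set ds \<subseteq> {0}" using flat_basis_indep[OF bs] by metis
    then have "set ks \<subseteq> {0}" using ds(3) by blast
    then have "set Ks \<subseteq> {\<zero>\<^bsub>arr_quotient A\<^esub>}"
      unfolding ks using ker[of 0] flat_ideal.zero[of N UNIV] by auto
    \<comment> \<open>The empty list also meets the condition that \<open>set Ks\<close> differs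
      from the singleton of zero; but then \<open>?U\<close> is empty and hence independent.\<close>
    then have "Ks = []" using Ks(4) by (cases Ks) auto
    then have "?U = []" using Ks(1) by simp
    then show False using \<open>\<not> H.S.independent ?K ?U\<close> by simp
  qed
  moreover have "H.S.Span ?K ?U = ?p ` super_part i j"
  proof (intro equalityI subsetI)
    fix x assume "x \<in> H.S.Span ?K ?U"
    then obtain Ks where Ks: "set Ks \<subseteq> ?K" "x = H.S.combine Ks ?U"
      unfolding H.S.Span_eq_combine_set[OF K U] by blast
    then obtain ks where "x = ?p (lin ks cs)" using ex_const comb by metis
    then show "x \<in> ?p ` super_part i j" using lin_in_super_part[OF cs_part] by auto
  next
    fix x assume "x \<in> ?p ` super_part i j"
    then obtain f where f: "f \<in> super_part i j" "x = ?p f" by auto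
    obtain ds where ds: "length ds = length bs" "f - lin ds bs \<in> flat_ideal N UNIV"
      using flat_basis_span[OF bs flat_algebra_UNIV] by blast
    obtain ks where ks: "super_comp i j (lin ds bs) = lin ks cs"
      using super_comp_lin[OF flat_basis_graded(2)[OF bs] ds(1), of i j] unfolding cs_def by blast
    \<comment> \<open>Taking the component of bidegree \<open>(i, j)\<close> fixes \<open>f\<close>,
      discards the other basis elements and stays in the ideal.\<close>
    have "f - lin ks cs \<in> flat_ideal N UNIV"
      using flat_ideal_comp[OF ds(2), of i j] f(1)
      by (simp add: linear_op_diff[OF linear_op_comp] ks super_part_iff)
    then have "x = H.S.combine (map ?p (map super_const ks)) ?U"
      unfolding comb f(2) by (rule cong)
    then show "x \<in> H.S.Span ?K ?U"
      unfolding H.S.Span_eq_combine_set[OF K U]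
      by (intro CollectI exI[of _ "map ?p (map super_const ks)"] conjI) auto
  qed
  ultimately have "H.S.dimension (length ?U) ?K (?p ` super_part i j)"
    using H.S.dimensionI[OF K] by blast
  then have "H.S.dim ?K (?p ` super_part i j) = length ?U"
    using H.S.dimI[OF K] unfolding over_def by blast
  then show ?thesis unfolding arr_quotient_dim_def by (simp add: cs_def)
qed

lemma coeff_Hilb:
  assumes "\<And>i j. d i j = length (filter (\<lambda>b. fst b = (i, j)) bs)"
  shows "poly.coeff (map_poly (\<lambda>p. poly p 1) (Hilb d)) j = int (length (filter (\<lambda>b. snd (fst b) = j) bs))"
proof -
  let ?D = "{(i, j). d i j \<noteq> 0}"
  \<comment> \<open>Only finitely many bidegrees occur, so the sum in \<open>Hilb\<close> is a
    genuine one and not the default 0.\<close>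
  have sub: "?D \<subseteq> set (map fst bs)"
    using assms by (force simp: filter_empty_conv)
  then have fin: "finite ?D" by (rule finite_subset) simp
  have "poly.coeff (map_poly (\<lambda>p. poly p 1) (Hilb d)) j = poly (poly.coeff (Hilb d) j) 1"
    by (rule coeff_map_poly) simp
  also have "\<dots> = (\<Sum>(i, j')\<in>?D. if j' = j then int (d i j') else 0)"
    unfolding Hilb_def Polynomial.coeff_sum poly_sum
    by (intro sum.cong) (auto simp: poly_monom)
  also have "\<dots> = (\<Sum>p\<in>set (map fst bs). if snd p = j then int (length (filter (\<lambda>b. fst b = p) bs)) else 0)"
    using sub by (intro sum.mono_neutral_cong_left) (auto simp: assms)
  also have "\<dots> = int (length (filter (\<lambda>b. snd (fst b) = j) bs))"
  proof -
    have "(\<Sum>p\<in>P. if snd p = j then int (length (filter (\<lambda>b. fst b = p) bs)) else 0) =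
        int (length (filter (\<lambda>b. snd (fst b) = j) bs))" if "finite P" "set (map fst bs) \<subseteq> P" for P
      using that(2)
    proof (induction bs)
      case (Cons b bs)
      have "(\<Sum>p\<in>P. if snd p = j then int (length (filter (\<lambda>b. fst b = p) (b # bs))) else 0) =
        (\<Sum>p\<in>P. (if snd p = j then int (length (filter (\<lambda>b. fst b = p) bs)) else 0) +
          (if p = fst b then if snd p = j then 1 else 0 else 0))"
        by (intro sum.cong) auto
      also have "\<dots> = int (length (filter (\<lambda>b. snd (fst b) = j) (b # bs)))"
        using Cons that(1) by (simp add: sum.distrib)
      finally show ?case .
    qed (simp cong: if_cong)
    then show ?thesis by simp
  qed
  finally show ?thesis .
qed

subsection \<open>Faces of a generic affine arrangement\<close>

definition complex_vec :: "real ^ 'n \<Rightarrow> complex ^ 'n" where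
  "complex_vec a = (\<chi> k. complex_of_real (a $ k))"

text \<open>A real normal acts on real and imaginary parts separately, in agreement with
  \<open>complexify\<close>.\<close>

lemma pair_complex_vec:
  "Re (pair (complex_vec a) l) = a \<bullet> (\<chi> k. Re (l $ k))"
  "Im (pair (complex_vec a) l) = a \<bullet> (\<chi> k. Im (l $ k))"
  by (simp_all add: pair_def complex_vec_def inner_vec_def)

lemma pair_complex_vec_real: "pair (complex_vec a) (complex_vec w) = complex_of_real (a \<bullet> w)"
  by (simp add: pair_def complex_vec_def inner_vec_def)

section \<open>Convexity, dual vectors and equations of hyperplanes\<close>

lemma sgn_convex_combination:
  fixes x y t :: real
  assumes "sgn x = sgn y" "0 \<le> t" "t \<le> 1"
  shows "sgn ((1 - t) * x + t * y) = sgn x"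
proof (cases x "0::real" rule: linorder_cases)
  case less
  then have "y < 0" using assms(1) by (metis sgn_less)
  then have "(1 - t) * x + t * y < 0" using less assms
    by (metis convex_bound_lt diff_add_cancel diff_ge_0_iff_ge)
  then show ?thesis using less by simp
next
  case equal
  then show ?thesis using assms(1) by (simp add: sgn_zero_iff)
next
  case greater
  then have "- y < 0" using assms(1) by (metis neg_less_0_iff_less sgn_greater)
  then have "(1 - t) * - x + t * - y < 0" using greater assms
    by (metis convex_bound_lt diff_add_cancel diff_ge_0_iff_ge neg_less_0_iff_less)
  then show ?thesis using greater by simp
qed

text \<open>The coordinate functional of \<open>c\<close> with respect to \<open>B\<close>,
  represented through the inner product by \<open>adjoint g 1\<close>.\<close>

lemma independent_dual_vector:
  fixes B :: "'a::euclidean_space set"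
  assumes "independent B" "c \<in> B"
  obtains w where "c \<bullet> w = 1" "\<And>x. x \<in> B - {c} \<Longrightarrow> x \<bullet> w = 0"
proof -
  obtain g :: "'a \<Rightarrow> real" where g: "linear g" "\<forall>x\<in>B. g x = (if x = c then 1 else 0)"
    using linear_independent_extend[OF assms(1), of "\<lambda>x. if x = c then 1 else (0::real)"] by blast
  have "g x = x \<bullet> adjoint g 1" for x
    using adjoint_works[OF g(1), of x 1] by (simp add: inner_commute)
  then show ?thesis using that[of "adjoint g 1"] g(2) assms(2) by auto
qed

text \<open>\<open>arr_cell\<close> ranges over all equations of a hyperplane, while sign vectors
  use one chosen equation; this reconciles them.\<close>

lemma hyperplane_eq_imp_proportional:
  fixes a c :: "'a::real_inner"
  assumes "{z. c \<bullet> z = d} = {z. a \<bullet> z = b}" "a \<noteq> 0"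
  obtains t where "c = t *\<^sub>R a" "d = t * b"
proof
  \<comment> \<open>\<open>?p\<close> is the point of the hyperplane nearest to the origin and
    \<open>?t *\<^sub>R a\<close> the projection of \<open>c\<close> onto \<open>a\<close>. The rest
    \<open>?z\<close> is parallel to the hyperplane, so it is orthogonal to \<open>c\<close> as well
    as to \<open>a\<close>, hence to itself.\<close>
  let ?t = "(c \<bullet> a) / (a \<bullet> a)" and ?p = "(b / (a \<bullet> a)) *\<^sub>R a"
  have "?p \<in> {z. a \<bullet> z = b}" using assms(2) by simp
  then have p: "c \<bullet> ?p = d" unfolding assms(1)[symmetric] by simp
  let ?z = "c - ?t *\<^sub>R a"
  have z: "a \<bullet> ?z = 0" using assms(2) by (simp add: inner_diff_right inner_commute)
  then have "?p + ?z \<in> {z. a \<bullet> z = b}" using assms(2) by (simp add: inner_add_right)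
  then have "c \<bullet> (?p + ?z) = d" unfolding assms(1)[symmetric] by simp
  then have "c \<bullet> ?z = 0" using p by (simp only: inner_add_right)
  then have "?z \<bullet> ?z = 0" using z by (simp add: inner_diff_left)
  then show c: "c = ?t *\<^sub>R a" by simp
  show "d = ?t * b" using p by (simp add: mult.commute)
qed

section \<open>Sign vectors of generic hyperplanes and their recursion\<close>

locale generic_hyperplanes =
  fixes a :: "nat \<Rightarrow> real ^ 'n::{finite,linorder}" and b :: "nat \<Rightarrow> real" and m :: nat
  assumes generic: "K \<subseteq> {..<m} \<Longrightarrow>
    (\<exists>x. \<forall>i\<in>K. a i \<bullet> x = b i) \<longleftrightarrow> inj_on a K \<and> independent (a ` K)"
begin

definition common :: "nat set \<Rightarrow> (real ^ 'n::{finite,linorder}) set" where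
  "common K = {x. \<forall>i\<in>K. a i \<bullet> x = b i}"

text \<open>The complexified direction space of the flat \<open>common K\<close>; it is the subspace
  reached on the algebraic side after contracting the normals in \<open>K\<close>.\<close>

definition directions :: "nat set \<Rightarrow> (complex ^ 'n::{finite,linorder}) set" where
  "directions K = {l. \<forall>i\<in>K. pair (complex_vec (a i)) l = 0}"

definition signs :: "nat list \<Rightarrow> real ^ 'n::{finite,linorder} \<Rightarrow> real list" where
  "signs is x = map (\<lambda>i. sgn (a i \<bullet> x - b i)) is"

text \<open>The cells that the hyperplanes in \<open>is\<close> cut out on the flat
  \<open>common K\<close>, encoded by their signs. A zero marks a hyperplane containing the cell, so
  for generic hyperplanes \<open>j\<close> is the codimension in the flat.\<close>

definition sign_vectors :: "nat set \<Rightarrow> nat list \<Rightarrow> nat \<Rightarrow> real list set" where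
  "sign_vectors K is j = {s \<in> signs is ` common K. length (filter (\<lambda>e. e = 0) s) = j}"

lemma signs_simps [simp]: "signs [] x = []" "signs (i # is) x = sgn (a i \<bullet> x - b i) # signs is x"
  by (simp_all add: signs_def)

lemma finite_signs: "finite (signs is ` N)"
proof (rule finite_subset)
  show "signs is ` N \<subseteq> {s. set s \<subseteq> {-1, 0, 1} \<and> length s = length is}"
    by (auto simp: signs_def sgn_if)
qed (rule finite_lists_length_eq, simp)

lemma common_dual_vector:
  assumes "K \<subseteq> {..<m}" "common K \<noteq> {}" "i \<in> K"
  obtains w where "a i \<bullet> w = 1" "\<And>k. k \<in> K - {i} \<Longrightarrow> a k \<bullet> w = 0"
proof -
  have K: "inj_on a K" "independent (a ` K)"
    using generic[OF assms(1)] assms(2) by (auto simp: common_def)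
  obtain w where w: "a i \<bullet> w = 1" "\<And>x. x \<in> a ` K - {a i} \<Longrightarrow> x \<bullet> w = 0"
    using independent_dual_vector[OF K(2), of "a i"] assms(3) by blast
  show thesis
  proof (rule that[OF w(1)])
    fix k assume "k \<in> K - {i}"
    then show "a k \<bullet> w = 0" using w(2) K(1) assms(3) by (auto simp: inj_on_def)
  qed
qed

text \<open>Moving inside the flat along a direction not parallel to hyperplane \<open>i\<close>
  reaches that hyperplane; conversely, if the two meet, genericity provides a direction of the flat
  on which \<open>a i\<close> is 1. So emptiness here is the loop test of
  \<open>flat_count\<close>.\<close>

lemma common_insert_empty_iff:
  assumes "insert i K \<subseteq> {..<m}" "i \<notin> K" "common K \<noteq> {}"
  shows "common (insert i K) = {} \<longleftrightarrow> (\<forall>l\<in>directions K. pair (complex_vec (a i)) l = 0)"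
proof
  assume empty: "common (insert i K) = {}"
  obtain x where x: "x \<in> common K" using assms(3) by auto
  have "a i \<bullet> w = 0" if w: "\<And>k. k \<in> K \<Longrightarrow> a k \<bullet> w = 0" for w
  proof (rule ccontr)
    assume "a i \<bullet> w \<noteq> 0"
    then have "x + ((b i - a i \<bullet> x) / (a i \<bullet> w)) *\<^sub>R w \<in> common (insert i K)"
      using x w by (auto simp: common_def inner_add_right)
    then show False using empty by blast
  qed
  then show "\<forall>l\<in>directions K. pair (complex_vec (a i)) l = 0"
    by (auto simp: directions_def complex_eq_iff pair_complex_vec)
next
  assume *: "\<forall>l\<in>directions K. pair (complex_vec (a i)) l = 0"
  show "common (insert i K) = {}"
  proof (rule ccontr)
    assume "common (insert i K) \<noteq> {}"
    then obtain w where "a i \<bullet> w = 1" "\<And>k. k \<in> insert i K - {i} \<Longrightarrow> a k \<bullet> w = 0"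
      using common_dual_vector[OF assms(1)] by blast
    moreover from this have "complex_vec w \<in> directions K"
      using assms(2) by (auto simp: directions_def pair_complex_vec_real)
    ultimately show False using * by (force simp: pair_complex_vec_real)
  qed
qed

text \<open>A point of hyperplane \<open>i\<close> is pushed slightly off it, to either side. The
  direction keeps all other equations that hold at \<open>x\<close>, and strict signs survive a
  small step.\<close>

lemma signs_perturb:
  assumes "insert i (K \<union> set is) \<subseteq> {..<m}" "i \<notin> K" "i \<notin> set is" "x \<in> common (insert i K)"
    "e = 1 \<or> e = (- 1 :: real)"
  shows "\<exists>y\<in>common K. signs is y = signs is x \<and> sgn (a i \<bullet> y - b i) = e"
proof -
  \<comment> \<open>The hyperplanes indexed by \<open>i\<close>, \<open>K\<close> and
    \<open>Z\<close> all pass through \<open>x\<close>, so by genericity their normals are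
    independent and a dual vector for \<open>i\<close> exists.\<close>
  define Z where "Z = {k \<in> set is. a k \<bullet> x = b k}"
  have Z: "x \<in> common (insert i (K \<union> Z))" using assms(4) by (auto simp: common_def Z_def)
  have "insert i (K \<union> Z) \<subseteq> {..<m}" using assms(1) by (auto simp: Z_def)
  then obtain w where w: "a i \<bullet> w = 1" "\<And>k. k \<in> insert i (K \<union> Z) - {i} \<Longrightarrow> a k \<bullet> w = 0"
    using common_dual_vector[of "insert i (K \<union> Z)" i] Z by blast
  have "\<forall>\<^sub>F t in at_right 0. sgn (a k \<bullet> (x + (e * t) *\<^sub>R w) - b k) = sgn (a k \<bullet> x - b k)"
    if k: "k \<in> set is" for k
  proof (cases "k \<in> Z")
    case True
    then have "a k \<bullet> w = 0" using w(2)[of k] assms(3) k by auto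
    then show ?thesis by (simp add: inner_add_right)
  next
    case False
    let ?f = "\<lambda>t. a k \<bullet> (x + (e * t) *\<^sub>R w) - b k"
    have lim: "(?f \<longlongrightarrow> ?f 0) (at_right 0)" by (intro tendsto_intros)
    have nz: "?f 0 \<noteq> 0" using False k by (simp add: Z_def)
    show ?thesis
    proof (cases "?f 0 > 0")
      case True
      then have "\<forall>\<^sub>F t in at_right 0. ?f t > 0" using order_tendstoD(1)[OF lim] by blast
      then show ?thesis by (rule eventually_mono) (use True in simp)
    next
      case False
      then have neg: "?f 0 < 0" using nz by linarith
      then have "\<forall>\<^sub>F t in at_right 0. ?f t < 0" using order_tendstoD(2)[OF lim] by blast
      then show ?thesis by (rule eventually_mono) (use neg in simp)
    qed
  qed
  then have "\<forall>\<^sub>F t in at_right 0. \<forall>k\<in>set is. sgn (a k \<bullet> (x + (e * t) *\<^sub>R w) - b k) = sgn (a k \<bullet> x - b k)"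
    by (simp add: eventually_ball_finite)
  moreover have "\<forall>\<^sub>F t in at_right (0::real). 0 < t"
    by (rule eventually_at_right_less)
  ultimately have "\<forall>\<^sub>F t in at_right 0. 0 < t \<and> (\<forall>k\<in>set is. sgn (a k \<bullet> (x + (e * t) *\<^sub>R w) - b k) = sgn (a k \<bullet> x - b k))"
    by eventually_elim simp
  then have "\<exists>t. 0 < t \<and> (\<forall>k\<in>set is. sgn (a k \<bullet> (x + (e * t) *\<^sub>R w) - b k) = sgn (a k \<bullet> x - b k))"
    by (rule eventually_happens'[OF trivial_limit_at_right_real])
  then obtain t where t: "0 < t" "\<And>k. k \<in> set is \<Longrightarrow> sgn (a k \<bullet> (x + (e * t) *\<^sub>R w) - b k) = sgn (a k \<bullet> x - b k)"
    by blast
  have "a k \<bullet> w = 0" if "k \<in> K" for k using w(2)[of k] that assms(2) by auto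
  then have "x + (e * t) *\<^sub>R w \<in> common K" using assms(4) by (auto simp: common_def inner_add_right)
  moreover have "sgn (a i \<bullet> (x + (e * t) *\<^sub>R w) - b i) = e"
    using assms(4,5) t(1) w(1) by (auto simp: common_def inner_add_right sgn_mult)
  ultimately show ?thesis using t(2) by (intro bexI[of _ "x + (e * t) *\<^sub>R w"]) (auto simp: signs_def)
qed

text \<open>By convexity the segment from \<open>x\<close> to \<open>y\<close> keeps the equations
  of \<open>K\<close> and the signs for \<open>is\<close>; at the parameter \<open>t\<close> it
  crosses hyperplane \<open>i\<close>.\<close>

lemma signs_between:
  assumes "x \<in> common K" "y \<in> common K" "signs is x = signs is y"
    "a i \<bullet> x - b i > 0" "a i \<bullet> y - b i < 0"
  shows "\<exists>z\<in>common (insert i K). signs is z = signs is x"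
proof -
  let ?u = "a i \<bullet> x - b i" and ?v = "a i \<bullet> y - b i"
  define t where "t = ?u / (?u - ?v)"
  have t: "0 \<le> t" "t \<le> 1" "(1 - t) * ?u + t * ?v = 0"
    using assms(4,5) by (auto simp: t_def field_simps)
  let ?z = "(1 - t) *\<^sub>R x + t *\<^sub>R y"
  have z: "a k \<bullet> ?z - b k = (1 - t) * (a k \<bullet> x - b k) + t * (a k \<bullet> y - b k)" for k
    by (simp add: inner_add_right algebra_simps)
  have "?z \<in> common (insert i K)"
    using assms(1,2) t(3) unfolding common_def by (auto simp: inner_add_right algebra_simps)
  moreover have "sgn (a k \<bullet> ?z - b k) = sgn (a k \<bullet> x - b k)" if "k \<in> set is" for k
    unfolding z using that assms(3) t by (intro sgn_convex_combination) (auto simp: signs_def)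
  ultimately show ?thesis by (intro bexI[of _ ?z]) (auto simp: signs_def)
qed

text \<open>Each sign vector for \<open>is\<close> on the flat occurs on at least one open side of
  hyperplane \<open>i\<close>, and those occurring on both sides are the ones occurring on the
  hyperplane. So the two sides together count the flat plus the smaller flat, and the points on the
  hyperplane add a third class with one more zero.\<close>

lemma card_sign_vectors_Cons:
  assumes "insert i (K \<union> set is) \<subseteq> {..<m}" "i \<notin> K" "i \<notin> set is" "common (insert i K) \<noteq> {}"
  shows "card (sign_vectors K (i # is) j) = card (sign_vectors K is j) +
    card (sign_vectors (insert i K) is j) +
    (case j of 0 \<Rightarrow> 0 | Suc k \<Rightarrow> card (sign_vectors (insert i K) is k))"
proof -
  define T where "T e = {s \<in> signs is ` {x \<in> common K. sgn (a i \<bullet> x - b i) = e}.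
    length (filter (\<lambda>e. e = 0) s) = j}" for e
  have fin: "finite (T e)" for e unfolding T_def using finite_signs by simp
  have fin': "finite (sign_vectors L is k)" for L k unfolding sign_vectors_def using finite_signs by simp
  have sub: "sign_vectors (insert i K) is j \<subseteq> T e" if "e = 1 \<or> e = -1" for e
    using signs_perturb[OF assms(1-3) _ that] unfolding sign_vectors_def T_def by (force simp: image_iff)
  have Int: "T 1 \<inter> T (-1) = sign_vectors (insert i K) is j"
  proof (intro equalityI subsetI)
    fix s assume "s \<in> T 1 \<inter> T (-1)"
    then obtain x y where xy: "x \<in> common K" "y \<in> common K" "s = signs is x" "s = signs is y"
      "sgn (a i \<bullet> x - b i) = 1" "sgn (a i \<bullet> y - b i) = -1" "length (filter (\<lambda>e. e = 0) s) = j"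
      unfolding T_def by auto
    obtain z where "z \<in> common (insert i K)" "signs is z = signs is x"
      using signs_between[OF xy(1,2), of "is" i] xy(3-6) unfolding sgn_1_pos sgn_1_neg by metis
    then show "s \<in> sign_vectors (insert i K) is j"
      unfolding sign_vectors_def xy(3) using xy(3,7) by (metis (mono_tags, lifting) CollectI imageI)
  qed (use sub in auto)
  have Un: "T 1 \<union> T (-1) = sign_vectors K is j"
  proof (intro equalityI subsetI)
    fix s assume "s \<in> sign_vectors K is j"
    then obtain x where x: "x \<in> common K" "s = signs is x" "length (filter (\<lambda>e. e = 0) s) = j"
      unfolding sign_vectors_def by auto
    show "s \<in> T 1 \<union> T (-1)"
    proof (cases "a i \<bullet> x = b i")
      case True
      then have "s \<in> sign_vectors (insert i K) is j"
        using x by (auto simp: sign_vectors_def common_def)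
      then show ?thesis using sub by blast
    next
      case False
      then have "sgn (a i \<bullet> x - b i) = 1 \<or> sgn (a i \<bullet> x - b i) = -1" by (auto simp: sgn_if)
      then show ?thesis using x by (auto simp: T_def)
    qed
  qed (auto simp: T_def sign_vectors_def)
  \<comment> \<open>The leading 0 is itself one of the \<open>j\<close> zeros, so the tail has one
    fewer, and there is none for \<open>j = 0\<close>.\<close>
  let ?Z = "case j of 0 \<Rightarrow> {} | Suc k \<Rightarrow> sign_vectors (insert i K) is k"
  have "sign_vectors K (i # is) j = (#) 1 ` T 1 \<union> ((#) (-1) ` T (-1) \<union> (#) 0 ` ?Z)"
  proof (intro equalityI subsetI)
    fix s assume "s \<in> sign_vectors K (i # is) j"
    then obtain x where x: "x \<in> common K" "s = signs (i # is) x" "length (filter (\<lambda>e. e = 0) s) = j"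
      unfolding sign_vectors_def by auto
    consider "a i \<bullet> x - b i = 0" | "sgn (a i \<bullet> x - b i) = 1" | "sgn (a i \<bullet> x - b i) = -1"
      by (cases "a i \<bullet> x - b i" "0::real" rule: linorder_cases) auto
    then show "s \<in> (#) 1 ` T 1 \<union> ((#) (-1) ` T (-1) \<union> (#) 0 ` ?Z)"
    proof cases
      case 1
      then have "signs is x \<in> ?Z"
        using x by (auto simp: sign_vectors_def common_def split: nat.split)
      then show ?thesis using 1 x by simp
    qed (use x in \<open>auto simp: T_def\<close>)
  qed (force simp: T_def sign_vectors_def common_def split: nat.splits)+
  moreover have "finite ?Z" using fin' by (auto split: nat.split)
  moreover have "card ((#) 1 ` A \<union> ((#) (-1) ` B \<union> (#) 0 ` C)) = card A + (card B + card C)"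
    if "finite A" "finite B" "finite C" for A B C :: "real list set"
  proof -
    have "card ((#) 1 ` A \<union> ((#) (-1) ` B \<union> (#) 0 ` C)) = card ((#) 1 ` A) + card ((#) (-1) ` B \<union> (#) 0 ` C)"
      using that by (intro card_Un_disjoint) auto
    also have "card ((#) (-1) ` B \<union> (#) 0 ` C) = card ((#) (-1) ` B) + card ((#) 0 ` C)"
      using that by (intro card_Un_disjoint) auto
    finally show ?thesis by (simp add: card_image)
  qed
  ultimately have "card (sign_vectors K (i # is) j) = card (T 1) + (card (T (-1)) + card ?Z)"
    using fin by simp
  moreover have "card (T 1) + card (T (-1)) = card (sign_vectors K is j) + card (sign_vectors (insert i K) is j)"
    using card_Un_Int[OF fin fin, of 1 "-1"] Int Un by simp
  moreover have "card ?Z = (case j of 0 \<Rightarrow> 0 | Suc k \<Rightarrow> card (sign_vectors (insert i K) is k))"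
    by (simp split: nat.split)
  ultimately show ?thesis by simp
qed

text \<open>The flat is convex and misses hyperplane \<open>i\<close>, so it lies strictly on one
  side and the new sign is constant.\<close>

lemma card_sign_vectors_parallel:
  assumes "common (insert i K) = {}" "common K \<noteq> {}"
  shows "card (sign_vectors K (i # is) j) = card (sign_vectors K is j)"
proof -
  obtain x where x: "x \<in> common K" using assms(2) by auto
  let ?e = "sgn (a i \<bullet> x - b i)"
  have e: "sgn (a i \<bullet> y - b i) = ?e" if y: "y \<in> common K" for y
  proof -
    have False if "a i \<bullet> x - b i > 0" "a i \<bullet> y - b i < 0" "x \<in> common K" "y \<in> common K" for x y
      using signs_between[of x K y "[]" i] that assms(1) by auto
    moreover have "a i \<bullet> x \<noteq> b i" "a i \<bullet> y \<noteq> b i"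
      using x y assms(1) by (auto simp: common_def)
    ultimately show ?thesis using x y by (smt (verit) sgn_pos sgn_neg)
  qed
  have "a i \<bullet> x \<noteq> b i" using x assms(1) by (auto simp: common_def)
  then have "sign_vectors K (i # is) j = (#) ?e ` sign_vectors K is j"
    using e by (auto simp: sign_vectors_def image_iff sgn_zero_iff)
  then show ?thesis by (simp add: card_image inj_on_def)
qed

theorem card_sign_vectors:
  assumes "K \<union> set is \<subseteq> {..<m}" "K \<inter> set is = {}" "distinct is" "common K \<noteq> {}"
  shows "card (sign_vectors K is j) = flat_count (map (\<lambda>i. complex_vec (a i)) is) (directions K) j"
  using assms
proof (induction "is" arbitrary: K j)
  case Nil
  then have "signs [] ` common K = {[]}" by auto
  then have "sign_vectors K [] j = (if j = 0 then {[]} else {})" by (auto simp: sign_vectors_def)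
  then show ?case by simp
next
  case (Cons i "is")
  have dir: "directions K \<inter> {l. pair (complex_vec (a i)) l = 0} = directions (insert i K)"
    by (auto simp: directions_def)
  have IH: "card (sign_vectors K is j) = flat_count (map (\<lambda>i. complex_vec (a i)) is) (directions K) j" for j
    using Cons.prems by (intro Cons.IH) auto
  have iff: "common (insert i K) = {} \<longleftrightarrow> (\<forall>l\<in>directions K. pair (complex_vec (a i)) l = 0)"
    using Cons.prems by (intro common_insert_empty_iff) auto
  show ?case
  proof (cases "common (insert i K) = {}")
    case True
    then show ?thesis
      using card_sign_vectors_parallel[OF True Cons.prems(4)] IH iff by simp
  next
    case False
    have IH': "card (sign_vectors (insert i K) is j) =
        flat_count (map (\<lambda>i. complex_vec (a i)) is) (directions (insert i K)) j" for j
      using Cons.prems False by (intro Cons.IH) auto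
    have "card (sign_vectors K (i # is) j) = card (sign_vectors K is j) +
        card (sign_vectors (insert i K) is j) +
        (case j of 0 \<Rightarrow> 0 | Suc k \<Rightarrow> card (sign_vectors (insert i K) is k))"
      using Cons.prems False by (intro card_sign_vectors_Cons) auto
    moreover have "\<not> (\<forall>l\<in>directions K. pair (complex_vec (a i)) l = 0)" using False iff by blast
    ultimately show ?thesis
      unfolding IH IH' by (simp only: list.map flat_count.simps dir if_False add.assoc)
  qed
qed

text \<open>The direction space is the orthogonal complement of the span of the normals, which are
  independent because the flat is nonempty.\<close>

lemma card_common_bound:
  assumes "K \<subseteq> {..<m}" "common K \<noteq> {}"
  shows "aff_dim (common K) = int CARD('n) - int (card K)" "card K \<le> CARD('n)"
proof -
  have K: "inj_on a K" "independent (a ` K)"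
    using generic[OF assms(1)] assms(2) by (auto simp: common_def)
  obtain x where x: "x \<in> common K" using assms(2) by auto
  let ?W = "{y \<in> UNIV. \<forall>x\<in>span (a ` K). orthogonal x y}"
  have W: "?W = {w. \<forall>i\<in>K. a i \<bullet> w = 0}"
  proof (intro equalityI subsetI)
    fix w assume "w \<in> {w. \<forall>i\<in>K. a i \<bullet> w = 0}"
    then have "\<And>x. x \<in> a ` K \<Longrightarrow> orthogonal w x" by (auto simp: orthogonal_def inner_commute)
    then have "orthogonal w x" if "x \<in> span (a ` K)" for x
      using that orthogonal_to_span by blast
    then show "w \<in> ?W" by (simp add: orthogonal_commute)
  qed (auto simp: orthogonal_def span_base)
  have "dim ?W + dim (span (a ` K)) = CARD('n)"
    using dim_subspace_orthogonal_to_vectors[OF subspace_span subspace_UNIV, of "a ` K"] by simp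
  moreover have "dim (span (a ` K)) = card K"
    using K by (simp add: dim_span dim_eq_card_independent card_image)
  ultimately have dim: "dim ?W + card K = CARD('n)" by simp
  then show "card K \<le> CARD('n)" by simp
  have "common K = (+) x ` ?W"
    unfolding W
  proof (intro equalityI subsetI)
    fix y assume "y \<in> common K"
    then show "y \<in> (+) x ` {w. \<forall>i\<in>K. a i \<bullet> w = 0}"
      using x by (intro image_eqI[of _ _ "y - x"]) (auto simp: common_def inner_diff_right)
  qed (use x in \<open>auto simp: common_def inner_add_right\<close>)
  moreover have "subspace ?W" unfolding W by (auto simp: subspace_def inner_add_right)
  ultimately show "aff_dim (common K) = int CARD('n) - int (card K)"
    using dim by (simp add: aff_dim_translation_eq aff_dim_subspace)
qed

definition cell :: "real list \<Rightarrow> (real ^ 'n::{finite,linorder}) set" where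
  "cell s = {y. signs [0..<m] y = s}"

text \<open>With \<open>Z\<close> the hyperplanes through a point of the cell, the cell is a
  nonempty relatively open part of the flat \<open>common Z\<close>, which is therefore its affine
  hull. Being convex as well, the cell is the relative interior of its closure, so distinct cells
  have distinct closures.\<close>

lemma cell_properties:
  assumes "s \<in> signs [0..<m] ` UNIV"
  shows "aff_dim (cell s) = int CARD('n) - int (length (filter (\<lambda>e. e = 0) s))"
    "length (filter (\<lambda>e. e = 0) s) \<le> CARD('n)"
    "rel_interior (closure (cell s)) = cell s"
proof -
  obtain x where x: "s = signs [0..<m] x" using assms by auto
  define Z where "Z = {i. i < m \<and> a i \<bullet> x = b i}"
  have Z: "Z \<subseteq> {..<m}" "x \<in> common Z" by (auto simp: Z_def common_def)
  define U where "U = (\<Inter>i\<in>{..<m} - Z. {y. sgn (a i \<bullet> y - b i) = sgn (a i \<bullet> x - b i)})"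
  have U: "open {y. sgn (a i \<bullet> y - b i) = sgn (a i \<bullet> x - b i)}" if "i \<in> {..<m} - Z" for i
  proof (cases "a i \<bullet> x > b i")
    case True
    then have "{y. sgn (a i \<bullet> y - b i) = sgn (a i \<bullet> x - b i)} = {y. a i \<bullet> y > b i}"
      by (auto simp: sgn_1_pos)
    then show ?thesis by (simp add: open_halfspace_gt)
  next
    case False
    then have "a i \<bullet> x < b i" using that by (auto simp: Z_def)
    then have "{y. sgn (a i \<bullet> y - b i) = sgn (a i \<bullet> x - b i)} = {y. a i \<bullet> y < b i}"
      by (auto simp: sgn_1_neg)
    then show ?thesis by (simp add: open_halfspace_lt)
  qed
  have openU: "open U" unfolding U_def using U by (intro open_INT) auto
  have cell: "cell s = common Z \<inter> U"
  proof (intro equalityI subsetI)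
    fix y assume "y \<in> cell s"
    then have *: "sgn (a i \<bullet> y - b i) = sgn (a i \<bullet> x - b i)" if "i < m" for i
      using that by (auto simp: cell_def x signs_def)
    then have "y \<in> common Z"
      by (auto simp: common_def Z_def) (metis (no_types, lifting) diff_self eq_iff_diff_eq_0 sgn_zero_iff)
    then show "y \<in> common Z \<inter> U" using * by (auto simp: U_def)
  next
    fix y assume y: "y \<in> common Z \<inter> U"
    have "sgn (a i \<bullet> y - b i) = sgn (a i \<bullet> x - b i)" if "i < m" for i
    proof (cases "i \<in> Z")
      case True
      then show ?thesis using y Z(2) by (simp add: common_def)
    next
      case False
      then show ?thesis using y that by (auto simp: U_def)
    qed
    then show "y \<in> cell s" by (auto simp: cell_def x signs_def)
  qed
  have aff: "affine (common Z)"
    by (auto simp: affine_def common_def inner_add_right distrib_right[symmetric])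
  have "x \<in> cell s" by (simp add: cell_def x)
  then have hull: "affine hull (cell s) = common Z"
    unfolding cell using affine_hull_affine_Int_open[OF aff openU] hull_same[of affine, OF aff] by auto
  have "{i. i < length s \<and> s ! i = 0} = Z"
    by (auto simp: x signs_def Z_def sgn_zero_iff)
  then have len: "length (filter (\<lambda>e. e = 0) s) = card Z"
    by (simp add: length_filter_conv_card)
  show "aff_dim (cell s) = int CARD('n) - int (length (filter (\<lambda>e. e = 0) s))"
    using card_common_bound(1)[OF Z(1)] Z(2) len hull aff_dim_affine_hull[of "cell s"] by auto
  show "length (filter (\<lambda>e. e = 0) s) \<le> CARD('n)"
    using card_common_bound(2)[OF Z(1)] Z(2) len by auto
  have conv: "convex (cell s)"
    unfolding convex_alt
  proof (intro ballI allI impI)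
    fix y z and t :: real assume *: "y \<in> cell s" "z \<in> cell s" "0 \<le> t \<and> t \<le> 1"
    have "a k \<bullet> ((1 - t) *\<^sub>R y + t *\<^sub>R z) - b k = (1 - t) * (a k \<bullet> y - b k) + t * (a k \<bullet> z - b k)" for k
      by (simp add: inner_add_right algebra_simps)
    then show "(1 - t) *\<^sub>R y + t *\<^sub>R z \<in> cell s"
      using * by (auto simp: cell_def x signs_def intro!: sgn_convex_combination[THEN trans])
  qed
  have "openin (top_of_set (affine hull cell s)) (cell s)"
    unfolding hull using openU by (auto simp: cell openin_open)
  then show "rel_interior (closure (cell s)) = cell s"
    using convex_rel_interior_closure[OF conv] rel_interior_openin by metis
qed

lemma card_faces:
  assumes G: "length G = m" "\<And>i. i < m \<Longrightarrow> a i \<noteq> 0 \<and> G ! i = {x. a i \<bullet> x = b i}" and j: "j \<le> CARD('n)"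
  shows "face_number (set G) (CARD('n) - j) = card (sign_vectors {} [0..<m] j)"
proof -
  have arr_cell: "arr_cell (set G) x = cell (signs [0..<m] x)" for x
  proof (intro equalityI subsetI)
    fix y assume y: "y \<in> arr_cell (set G) x"
    have "sgn (a i \<bullet> y - b i) = sgn (a i \<bullet> x - b i)" if "i < m" for i
    proof -
      have "{z. a i \<bullet> z = b i} \<in> set G" using G that by (metis nth_mem)
      then show ?thesis using y G(2)[OF that] unfolding arr_cell_def by blast
    qed
    then show "y \<in> cell (signs [0..<m] x)" by (simp add: cell_def signs_def)
  next
    fix y assume y: "y \<in> cell (signs [0..<m] x)"
    show "y \<in> arr_cell (set G) x"
      unfolding arr_cell_def
    proof (intro CollectI allI impI)
      fix c d assume c: "c \<noteq> 0 \<and> {z. c \<bullet> z = d} \<in> set G"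
      then obtain i where i: "i < m" "{z. c \<bullet> z = d} = {z. a i \<bullet> z = b i}"
        using G by (metis in_set_conv_nth)
      then obtain t where "c = t *\<^sub>R a i" "d = t * b i"
        using hyperplane_eq_imp_proportional[OF i(2)] G(2)[OF i(1)] by blast
      then have "c \<bullet> z - d = t * (a i \<bullet> z - b i)" for z by (simp add: algebra_simps)
      moreover have "sgn (a i \<bullet> y - b i) = sgn (a i \<bullet> x - b i)"
        using y i(1) by (auto simp: cell_def signs_def)
      ultimately show "sgn (c \<bullet> y - d) = sgn (c \<bullet> x - d)" by (simp add: sgn_mult)
    qed
  qed
  have common: "common {} = UNIV" by (simp add: common_def)
  have "arr_faces (set G) (CARD('n) - j) = (\<lambda>s. closure (cell s)) ` sign_vectors {} [0..<m] j"
  proof (intro equalityI subsetI)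
    fix F assume "F \<in> arr_faces (set G) (CARD('n) - j)"
    then obtain x where F: "F = closure (cell (signs [0..<m] x))" "aff_dim F = int (CARD('n) - j)"
      by (auto simp: arr_faces_def arr_cell)
    then have "signs [0..<m] x \<in> sign_vectors {} [0..<m] j"
      using cell_properties(1)[of "signs [0..<m] x"] j by (auto simp: sign_vectors_def common)
    then show "F \<in> (\<lambda>s. closure (cell s)) ` sign_vectors {} [0..<m] j" using F(1) by blast
  next
    fix F assume "F \<in> (\<lambda>s. closure (cell s)) ` sign_vectors {} [0..<m] j"
    then obtain x where F: "F = closure (cell (signs [0..<m] x))"
      "length (filter (\<lambda>e. e = 0) (signs [0..<m] x)) = j"
      by (auto simp: sign_vectors_def)
    then show "F \<in> arr_faces (set G) (CARD('n) - j)"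
      using cell_properties(1)[of "signs [0..<m] x"] j by (auto simp: arr_faces_def arr_cell)
  qed
  \<comment> \<open>A face determines its cell as its relative interior, and a nonempty cell
    determines its sign vector.\<close>
  moreover have "inj_on (\<lambda>s. closure (cell s)) (sign_vectors {} [0..<m] j)"
  proof (rule inj_onI)
    fix s s' assume *: "s \<in> sign_vectors {} [0..<m] j" "s' \<in> sign_vectors {} [0..<m] j"
      "closure (cell s) = closure (cell s')"
    then have "cell s = cell s'"
      using cell_properties(3)[of s] cell_properties(3)[of s'] by (auto simp: sign_vectors_def)
    then show "s = s'" using *(1) by (auto simp: sign_vectors_def cell_def)
  qed
  ultimately show ?thesis by (simp add: face_number_def card_image)
qed

text \<open>At most \<open>CARD('n)\<close> hyperplanes pass through a point, their normals being
  independent. This takes care of the coefficients beyond degree \<open>CARD('n)\<close>.\<close>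

lemma sign_vectors_empty:
  assumes "CARD('n) < j" shows "sign_vectors {} [0..<m] j = {}"
proof (rule equals0I)
  fix s assume "s \<in> sign_vectors {} [0..<m] j"
  then have "s \<in> signs [0..<m] ` UNIV" "length (filter (\<lambda>e. e = 0) s) = j"
    by (auto simp: sign_vectors_def)
  then show False using cell_properties(2)[of s] assms by simp
qed

end

theorem corollary4p6:
  fixes A G :: "(real ^ 'n::{finite,linorder}) set list"
  assumes "\<forall>H\<in>set A. linear_hyperplane H"
    and "generic_arrangement A G"
  shows "map_poly (\<lambda>p. poly p 1) (Hilb (arr_quotient_dim (map complexify A))) =
    (\<Sum>i\<le>CARD('n). Polynomial.monom (int (face_number (set G) (CARD('n) - i))) i)"
proof -
  let ?m = "length A"
  have len: "length G = ?m" and trans: "\<forall>i<?m. \<exists>v. G ! i = (+) v ` (A ! i)"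
    and ex: "\<exists>a :: nat \<Rightarrow> real ^ 'n::{finite,linorder}. (\<forall>i<?m. a i \<noteq> 0 \<and> A ! i = {x. a i \<bullet> x = 0}) \<and>
      (\<forall>K\<subseteq>{..<?m}. (\<Inter>i\<in>K. G ! i) \<noteq> {} \<longleftrightarrow> inj_on a K \<and> independent (a ` K))"
    using assms(2) unfolding generic_arrangement_def by simp_all
  from ex obtain a :: "nat \<Rightarrow> real ^ 'n::{finite,linorder}" where
    a: "\<forall>i<?m. a i \<noteq> 0 \<and> A ! i = {x. a i \<bullet> x = 0}" and
    gen: "\<forall>K\<subseteq>{..<?m}. (\<Inter>i\<in>K. G ! i) \<noteq> {} \<longleftrightarrow> inj_on a K \<and> independent (a ` K)"
    by (elim exE conjE)
  obtain v where v: "\<And>i. i < ?m \<Longrightarrow> G ! i = (+) (v i) ` (A ! i)" using trans by metis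
  \<comment> \<open>Translation by \<open>v i\<close> moves the level of the hyperplane from 0 to
    this value.\<close>
  define b where "b i = a i \<bullet> v i" for i
  have G: "a i \<noteq> 0 \<and> G ! i = {x. a i \<bullet> x = b i}" if "i < ?m" for i
  proof -
    have "(+) (v i) ` {x. a i \<bullet> x = 0} = {x. a i \<bullet> x = b i}"
    proof (intro equalityI subsetI)
      fix y assume "y \<in> {x. a i \<bullet> x = b i}"
      then show "y \<in> (+) (v i) ` {x. a i \<bullet> x = 0}"
        by (intro image_eqI[of _ _ "y - v i"]) (auto simp: b_def inner_diff_right)
    qed (auto simp: b_def inner_add_right)
    then show ?thesis using a v[OF that] that by simp
  qed
  interpret generic_hyperplanes a b ?m
  proof
    fix K assume K: "K \<subseteq> {..<?m}"
    have "(\<Inter>i\<in>K. G ! i) = {x. \<forall>i\<in>K. a i \<bullet> x = b i}" using G K by auto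
    then show "(\<exists>x. \<forall>i\<in>K. a i \<bullet> x = b i) \<longleftrightarrow> inj_on a K \<and> independent (a ` K)"
      using gen[rule_format, OF K] by auto
  qed
  let ?N = "map (\<lambda>i. complex_vec (a i)) [0..<?m]"
  have "arr_ideal (map complexify A) = flat_ideal ?N UNIV"
  proof (rule arr_ideal_eq_flat_ideal)
    fix i assume "i < length (map complexify A)"
    then show "map complexify A ! i = {z. pair (?N ! i) z = 0}"
      using a by (auto simp: complexify_def complex_eq_iff pair_complex_vec)
  qed simp
  moreover obtain bs where bs: "flat_basis ?N UNIV bs"
    "\<And>j. length (filter (\<lambda>b. snd (fst b) = j) bs) = flat_count ?N UNIV j"
    using flat_basis_exists[of UNIV ?N] by auto
  ultimately have dim: "arr_quotient_dim (map complexify A) i j = length (filter (\<lambda>b. fst b = (i, j)) bs)" for i j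
    by (intro arr_quotient_dim_eq)
  \<comment> \<open>For the empty set of hyperplanes the flat and its direction space are the whole
    real and complex space, so both recursions start from the same data.\<close>
  have count: "flat_count ?N UNIV j = card (sign_vectors {} [0..<?m] j)" for j
    using card_sign_vectors[of "{}" "[0..<?m]" j] by (auto simp: directions_def common_def lessThan_atLeast0)
  show ?thesis
  proof (rule poly_eqI)
    fix j
    have "poly.coeff (map_poly (\<lambda>p. poly p 1) (Hilb (arr_quotient_dim (map complexify A)))) j =
        int (card (sign_vectors {} [0..<?m] j))"
      unfolding coeff_Hilb[of "arr_quotient_dim (map complexify A)", OF dim] bs(2) count ..
    also have "\<dots> = (if j \<le> CARD('n) then int (face_number (set G) (CARD('n) - j)) else 0)"
      using card_faces[OF len G] sign_vectors_empty[of j] by auto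
    also have "\<dots> = poly.coeff (\<Sum>i\<le>CARD('n). Polynomial.monom (int (face_number (set G) (CARD('n) - i))) i) j"
      by (simp add: Polynomial.coeff_sum)
    finally show "poly.coeff (map_poly (\<lambda>p. poly p 1) (Hilb (arr_quotient_dim (map complexify A)))) j =
      poly.coeff (\<Sum>i\<le>CARD('n). Polynomial.monom (int (face_number (set G) (CARD('n) - i))) i) j" .
  qed
qed

end
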